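(* Let $t\in(0,\infty)$, $\alpha\in(0,1)$, $0<\beta<\alpha+1$, $\lambda\in\mathbb{C}$. Choose $c>\max\{\operatorname{Re}\lambda,0\}$. Cut the plane along the negative real axis, the origin being the branch point. With $R$ large and $\rho>0$ small, let $\Gamma$ be the closed integration contour, directed so that the enclosed region lies on the left, formed by the following consecutive pieces: - arc $AB$: $z=c-Re^{i\theta}$, $\theta\in(-\frac{\pi}{2},0)$; - segment $BC$: $z=r$, $r\in(c-R,-\rho)$, on the upper side of the cut; - arc $CD$ around the origin: $z=\rho e^{-i\theta}$, $\theta\in(-\pi,\pi)$; - segment $DE$: $z=-r$, $r\in(\rho,R-c)$, on the lower side of the cut; - arc $EF$: $z=c-Re^{i\theta}$, $\theta\in(0,\frac{\pi}{2})$; - segment $FA$: $z=c+iu$, $u\in(-R,R)$. Then $$\frac{1}{2\pi i}\int_{\Gamma}e^{zt}\frac{z^{\alpha-\beta}}{z^{\alpha}-\lambda}\,dz=\mathop{\mathrm{Res}}_{z=\lambda^{1/\alpha}}\frac{e^{zt}z^{\alpha-\beta}}{z^{\alpha}-\lambda},$$ and, letting $\rho\to0$ and $R\to\infty$, $$t^{\beta-1}E_{\alpha,\beta}(\lambda t^{\alpha})=\mathop{\mathrm{Res}}_{z=\lambda^{1/\alpha}}\frac{e^{zt}z^{\alpha-\beta}}{z^{\alpha}-\lambda}+\frac{1}{\pi}\int_{0}^{\infty}e^{-vt}v^{\alpha-\beta}\,\frac{v^{\alpha}\sin(\beta\pi)+\lambda\sin((\alpha-\beta)\pi)}{v^{2\alpha}-2\lambda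 v^{\alpha}\cos(\alpha\pi)+\lambda^{2}}\,dv.$$
   Context: The Mittag-Leffler function is $E_{\alpha,\beta}(z)=\sum_{k=0}^{\infty}\frac{z^{k}}{\Gamma(k\alpha+\beta)}$ for $\alpha>0$, $\beta>0$, $z\in\mathbb{C}$, where $\Gamma(\cdot)$ in this series is the gamma function. Powers of $z$ are taken with the principal branch, $z^{s}=\exp(s\,\mathrm{Ln}\,z)$, on the plane cut along the negative real axis, with $\mathrm{Ln}\,z=\ln|z|+i\pi$ on the upper side and $\mathrm{Ln}\,z=\ln|z|-i\pi$ on the lower side of the cut. The residue at $z=\lambda^{1/\alpha}$ is the residue of this branch at the point of the cut plane where $z^{\alpha}=\lambda$; it is understood to be $0$ when there is no such point (in particular for $\lambda<0$).
   Formalization: Added conditions: |arg λ| ≠ απ (else a pole lies on the cut and the integrals diverge); for the contour identity, Re λ^{1/α} < c whenever this root exists; for the second identity, λ ≠ 0 or β < 1 (for λ = 0, β = 1 it reads 1 = 0; for β > 1 the integral diverges). *)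

theory Defs
  imports "HOL-Complex_Analysis.Complex_Analysis"
begin

definition mittag_leffler :: "real \<Rightarrow> real \<Rightarrow> complex \<Rightarrow> complex" where
  "mittag_leffler \<alpha> \<beta> z = (\<Sum>k. z ^ k / of_real (Gamma (real k * \<alpha> + \<beta>)))"

(* The library logarithm has imaginary part pi on the negative real axis, which is its boundary
   value on the upper side of the cut.  The logarithm below agrees with it off the cut and takes
   the boundary value on the lower side, with imaginary part -pi. *)
definition Ln_lower :: "complex \<Rightarrow> complex" where
  "Ln_lower z = (if z \<in> \<real>\<^sub>\<le>\<^sub>0 then ln z - 2 * of_real pi * \<i> else ln z)"

(* exp (z t) z^(alpha - beta) / (z^alpha - lambda), with powers z^s = exp (s L(z)). *)
definition integrand ::
  "real \<Rightarrow> real \<Rightarrow> real \<Rightarrow> complex \<Rightarrow> (complex \<Rightarrow> complex) \<Rightarrow> complex \<Rightarrow> complex" where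
  "integrand t \<alpha> \<beta> l L z =
     exp (z * of_real t) * exp (of_real (\<alpha> - \<beta>) * L z) / (exp (of_real \<alpha> * L z) - l)"

(* Excluding the closed negative axis leaves out the branch point 0, where "z powr s" is 0. *)
definition is_branch_root :: "real \<Rightarrow> complex \<Rightarrow> complex \<Rightarrow> bool" where
  "is_branch_root \<alpha> l z \<longleftrightarrow> z \<notin> \<real>\<^sub>\<le>\<^sub>0 \<and> z powr of_real \<alpha> = l"

(* For 0 < alpha < 1 there is at most one such root, so the description below is proper. *)
definition branch_residue :: "real \<Rightarrow> real \<Rightarrow> real \<Rightarrow> complex \<Rightarrow> complex" where
  "branch_residue t \<alpha> \<beta> l =
     (if \<exists>z. is_branch_root \<alpha> l z
      then residue (integrand t \<alpha> \<beta> l ln) (THE z. is_branch_root \<alpha> l z) else 0)"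

(* The pieces AB, BC, CD, DE, EF, FA in this order.  DE runs along the lower side of the cut, and
   EF starts there; the other pieces use the principal logarithm.  The arcs AB and EF
   are z = c - R exp (i theta), hence the radius -R; CD is rho exp (- i theta) for theta in
   (-pi, pi), so it runs clockwise from argument pi to argument -pi. *)
definition cut_contour_integral ::
  "real \<Rightarrow> real \<Rightarrow> real \<Rightarrow> ((complex \<Rightarrow> complex) \<Rightarrow> complex \<Rightarrow> complex) \<Rightarrow> complex" where
  "cut_contour_integral c R \<rho> F =
     contour_integral (part_circlepath (of_real c) (- R) (- (pi / 2)) 0) (F ln)
   + contour_integral (linepath (of_real (c - R)) (of_real (- \<rho>))) (F ln)
   + contour_integral (part_circlepath 0 \<rho> pi (- pi)) (F ln)
   + contour_integral (linepath (of_real (- \<rho>)) (of_real (c - R))) (F Ln_lower)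
   + contour_integral (part_circlepath (of_real c) (- R) 0 (pi / 2)) (F Ln_lower)
   + contour_integral (linepath (of_real c - \<i> * of_real R) (of_real c + \<i> * of_real R)) (F ln)"

definition cut_density :: "real \<Rightarrow> real \<Rightarrow> real \<Rightarrow> complex \<Rightarrow> real \<Rightarrow> complex" where
  "cut_density t \<alpha> \<beta> l v =
     of_real (exp (- v * t) * v powr (\<alpha> - \<beta>))
     * ((of_real (v powr \<alpha> * sin (\<beta> * pi)) + l * of_real (sin ((\<alpha> - \<beta>) * pi)))
        / (of_real (v powr (2 * \<alpha>)) - 2 * l * of_real (v powr \<alpha> * cos (\<alpha> * pi)) + l\<^sup>2))"

end

theory Submission
  imports Defs
begin

text \<open>In the coordinate w = Ln z the integrand is single-valued and meromorphic, and on a strip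
  slightly wider than |Im w| \<le> pi its only pole is Ln z0, where z0 is the branch root. Hence it is a
  multiple of the logarithmic derivative of exp w - z0 plus a holomorphic function with a primitive P.
  Along the closed contour the increments of P (L z) telescope, L being the branch of the logarithm
  used on each piece, and what is left is the integral of 1 / (z - z0) around a half-disc.

  For the second identity the contour is taken to be Hankel's: a circle of radius r together with
  the two sides of the cut outside it. If r^alpha > |l|, the integrand is a geometric series
  there, and by Hankel's formula for 1 / Gamma it integrates termwise to the
  Mittag-Leffler series. Shrinking r to 0 crosses the pole, which gives the residue, and leaves only
  the jump across the cut. Hankel's formula itself follows from the same shrinking with l = 0 for
  0 < s < 1, and for the other s from the functional equation of Gamma.\<close>

section \<open>Branch roots and the pole of the integrand\<close>

text \<open>The obstacle is that the cut belongs to the contour: BC and DE carry different boundary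
  values over the same segment, so Cauchy's theorem does not apply directly in z. In w the two sides
  are the distinct lines Im w = pi and Im w = - pi. On them z^alpha has argument alpha pi or - alpha
  pi, so \<open>\<bar>Arg l\<bar> \<noteq> \<alpha> * pi\<close> keeps poles off these lines and
  leaves room for a wider strip. Hankel's contour suits the second identity because exp (t z) decays
  exponentially along it and all its integrals converge absolutely; on the vertical line through c
  the integrand only has the size |z|^(- beta), which is not absolutely integrable for beta \<le> 1.
  The condition r^alpha > |l| of the series also makes the circle enclose the pole, whose modulus is
  |l|^(1/alpha); hence the pole is crossed when r shrinks.\<close>

text \<open>Removable singularities twice: the difference quotient \<open>q\<close> of
  \<open>g\<close> at \<open>a\<close> is holomorphic and zero-free, so \<open>F = f / q\<close> is
  holomorphic, and the remainder \<open>h\<close> is the difference quotient of \<open>F\<close> at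
  \<open>a\<close>.\<close>

lemma simple_pole_split:
  assumes "open S" "f holomorphic_on S" "g holomorphic_on S" "a \<in> S" "g a = 0"
    and der: "(g has_field_derivative g') (at a)" and "g' \<noteq> 0"
    and nz: "\<And>w. w \<in> S \<Longrightarrow> w \<noteq> a \<Longrightarrow> g w \<noteq> (0::complex)"
  obtains h where "h holomorphic_on S"
    "\<And>w. w \<in> S \<Longrightarrow> w \<noteq> a \<Longrightarrow> f w / g w = (f a / g') / (w - a) + h w"
proof -
  define q where "q = (\<lambda>w. if w = a then deriv g a else (g w - g a) / (w - a))"
  define F where "F = (\<lambda>w. f w / q w)"
  define h where "h = (\<lambda>w. if w = a then deriv F a else (F w - F a) / (w - a))"
  have "q holomorphic_on S" unfolding q_def
    using assms by (intro pole_lemma_open)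
  moreover have q_a: "q a = g'"
    using der by (simp add: q_def DERIV_imp_deriv)
  moreover have "q w \<noteq> 0" if "w \<in> S" for w
    using that nz[of w] assms(5,7) q_a by (cases "w = a") (auto simp: q_def)
  ultimately have "F holomorphic_on S"
    unfolding F_def using assms(2) by (intro holomorphic_intros) auto
  then have "h holomorphic_on S" unfolding h_def
    using assms(1) by (rule pole_lemma_open)
  moreover have "f w / g w = (f a / g') / (w - a) + h w" if "w \<in> S" "w \<noteq> a" for w
  proof -
    have "F w = f w * (w - a) / g w" "F a = f a / g'"
      using that assms(5) q_a by (auto simp: F_def q_def)
    then show ?thesis using that nz[of w]
      by (simp add: h_def diff_divide_distrib)
  qed
  ultimately show ?thesis by (rule that)
qed

text \<open>The solutions are alpha w = Ln l + 2 n pi i. As alpha * eta \<le> pi, only n = 0 can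
  occur in the strip, so that |Im w| = |Arg l| / alpha, which differs from pi by hypothesis.\<close>

lemma exp_eq_on_strip:
  fixes w :: complex
  assumes "0 < \<alpha>" "\<alpha> < 1" "\<bar>Arg l\<bar> \<noteq> \<alpha> * pi"
  obtains \<eta> where "\<eta> > pi"
    "\<And>w. \<bar>Im w\<bar> < \<eta> \<Longrightarrow> exp (of_real \<alpha> * w) = l \<Longrightarrow> \<bar>Im w\<bar> < pi"
proof -
  \<comment> \<open>If |Arg l| / alpha exceeds pi, it is itself the half-width, and the open strip
    contains no solution. Otherwise the solutions already lie inside |Im w| < pi, and pi / alpha is
    the largest half-width that excludes n \<noteq> 0.\<close>
  define \<eta> where "\<eta> = (if \<bar>Arg l\<bar> > \<alpha> * pi then \<bar>Arg l\<bar> / \<alpha> else pi / \<alpha>)"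
  have "\<eta> > pi"
    using assms by (auto simp: \<eta>_def field_simps)
  moreover have "\<bar>Im w\<bar> < pi" if w: "\<bar>Im w\<bar> < \<eta>" "exp (of_real \<alpha> * w) = l" for w
  proof -
    have "l \<noteq> 0" using w(2) by auto
    then have "exp (of_real \<alpha> * w) = exp (Ln l)" using w(2) by simp
    then obtain n :: int where "of_real \<alpha> * w = Ln l + (of_int (2 * n) * pi) * \<i>"
      unfolding exp_eq by blast
    then have "Im (of_real \<alpha> * w) = Im (Ln l + (of_int (2 * n) * pi) * \<i>)" by simp
    then have eq: "\<alpha> * Im w = Arg l + 2 * n * pi"
      using \<open>l \<noteq> 0\<close> by (simp add: Arg_eq_Im_Ln)
    have Arg: "- pi < Arg l" "Arg l \<le> pi" using Arg_bounded by auto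
    have lt: "\<bar>\<alpha> * Im w\<bar> < \<alpha> * \<eta>" using w(1) assms(1) by (simp add: abs_mult)
    also have "\<alpha> * \<eta> \<le> pi" using assms(1) Arg by (auto simp: \<eta>_def)
    finally have lt': "\<bar>Arg l + 2 * n * pi\<bar> < pi" using eq by simp
    have "n = 0"
    proof (rule ccontr)
      assume "n \<noteq> 0"
      then consider "n \<ge> 1" | "n \<le> -1" by linarith
      then show False
      proof cases
        case 1
        then have "1 * pi \<le> real_of_int n * pi" by (intro mult_right_mono) auto
        then show False using lt' Arg by linarith
      next
        case 2
        then have "real_of_int n * pi \<le> -1 * pi" by (intro mult_right_mono) auto
        then show False using lt' Arg by linarith
      qed
    qed
    then have "\<alpha> * \<bar>Im w\<bar> = \<bar>Arg l\<bar>" using eq assms(1) by (metis abs_mult abs_of_pos add.right_neutral mult_zero_left mult_zero_right of_int_0)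
    moreover have "\<bar>Arg l\<bar> < \<alpha> * pi"
      using lt eq \<open>n = 0\<close> assms by (auto simp: \<eta>_def split: if_splits)
    ultimately show "\<bar>Im w\<bar> < pi" using assms(1) by (metis mult_less_cancel_left_pos)
  qed
  ultimately show ?thesis using that by blast
qed

lemma is_branch_root_exp_iff:
  assumes "\<bar>Im w\<bar> < pi"
  shows "is_branch_root \<alpha> l (exp w) \<longleftrightarrow> exp (of_real \<alpha> * w) = l"
proof -
  have Ln: "Ln (exp w) = w" using assms by (intro Ln_exp) auto
  have "exp w \<notin> \<real>\<^sub>\<le>\<^sub>0"
  proof
    assume "exp w \<in> \<real>\<^sub>\<le>\<^sub>0"
    then have "Re (exp w) \<le> 0" "Im (exp w) = 0" by (auto simp: complex_nonpos_Reals_iff)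
    moreover have "exp w \<noteq> 0" by simp
    ultimately have "Re (exp w) < 0 \<and> Im (exp w) = 0"
      by (metis complex_eq_iff order_le_less zero_complex.simps)
    then have "Im (Ln (exp w)) = pi" using Im_Ln_eq_pi[of "exp w"] by simp
    then show False using assms Ln by simp
  qed
  then show ?thesis
    by (simp add: is_branch_root_def powr_def Ln)
qed

lemma abs_Im_Ln_less_pi:
  assumes "z \<notin> \<real>\<^sub>\<le>\<^sub>0" shows "\<bar>Im (Ln z)\<bar> < pi"
proof -
  have "z \<noteq> 0" using assms by auto
  moreover have "\<not> (Re z < 0 \<and> Im z = 0)"
    using assms by (auto simp: complex_nonpos_Reals_iff)
  ultimately show ?thesis
    using Im_Ln_eq_pi[of z] mpi_less_Im_Ln[of z] Im_Ln_le_pi[of z] by linarith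
qed

text \<open>\<open>exp\<close> is injective where imaginary parts differ by less than 2 pi; off the
  cut this holds for the logarithms, and multiplying by alpha < 1 preserves it.\<close>

lemma is_branch_root_unique:
  assumes "0 < \<alpha>" "\<alpha> < 1" "is_branch_root \<alpha> l z" "is_branch_root \<alpha> l z'"
  shows "z' = z"
proof -
  have nz: "z \<noteq> 0" "z' \<noteq> 0" and Im: "\<bar>Im (Ln z)\<bar> < pi" "\<bar>Im (Ln z')\<bar> < pi"
    using assms(3,4) abs_Im_Ln_less_pi by (auto simp: is_branch_root_def)
  have "exp (of_real \<alpha> * Ln z') = exp (of_real \<alpha> * Ln z)"
    using assms(3,4) nz by (simp add: is_branch_root_def powr_def)
  then have "of_real \<alpha> * Ln z' = of_real \<alpha> * Ln z"
  proof (rule exp_complex_eqI[rotated])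
    have "\<bar>\<alpha> * Im (Ln z') - \<alpha> * Im (Ln z)\<bar> = \<alpha> * \<bar>Im (Ln z') - Im (Ln z)\<bar>"
      using assms(1) by (simp add: abs_mult right_diff_distrib [symmetric])
    also have "\<dots> \<le> 1 * \<bar>Im (Ln z') - Im (Ln z)\<bar>"
      using assms(2) by (intro mult_right_mono) auto
    also have "\<dots> < 2 * pi" using Im abs_triangle_ineq4[of "Im (Ln z')" "Im (Ln z)"] by simp
    finally show "\<bar>Im (of_real \<alpha> * Ln z') - Im (of_real \<alpha> * Ln z)\<bar> < 2 * pi" by simp
  qed
  then show ?thesis using assms(1) nz by (metis exp_Ln mult_cancel_left of_real_eq_0_iff less_irrefl)
qed

text \<open>Lets the cases with and without a root share one proof: \<open>z0\<close> is the root if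
  there is one and the placeholder \<open>z1\<close> otherwise. \<open>Q\<close> is the position
  relative to the contour that the application requires.\<close>

lemma obtain_branch_root:
  assumes "0 < \<alpha>" "\<alpha> < 1"
    and "z1 \<notin> \<real>\<^sub>\<le>\<^sub>0" "Q z1" "\<And>z. is_branch_root \<alpha> l z \<Longrightarrow> Q z"
  obtains z0 where "z0 \<notin> \<real>\<^sub>\<le>\<^sub>0" "\<And>z. is_branch_root \<alpha> l z \<Longrightarrow> z = z0" "Q z0"
proof (cases "\<exists>z. is_branch_root \<alpha> l z")
  case True
  then obtain z where z: "is_branch_root \<alpha> l z" ..
  show ?thesis
  proof (rule that)
    show "z \<notin> \<real>\<^sub>\<le>\<^sub>0" using z by (simp add: is_branch_root_def)
    show "z' = z" if "is_branch_root \<alpha> l z'" for z'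
      using is_branch_root_unique[OF assms(1,2) z that] .
    show "Q z" using assms(5)[OF z] .
  qed
next
  case False
  show ?thesis
    by (rule that[of z1]) (use False assms(3,4) in auto)
qed

text \<open>The integrand times dz/dw in the coordinate z = exp w, where both sides of the cut
  lie in the interior of one strip.\<close>

definition log_integrand :: "real \<Rightarrow> real \<Rightarrow> real \<Rightarrow> complex \<Rightarrow> complex \<Rightarrow> complex" where
  "log_integrand t \<alpha> \<beta> l w =
     exp (exp w * of_real t + of_real (\<alpha> - \<beta> + 1) * w) / (exp (of_real \<alpha> * w) - l)"

lemma integrand_eq_log_integrand:
  assumes "exp (L z) = z"
  shows "integrand t \<alpha> \<beta> l L z = log_integrand t \<alpha> \<beta> l (L z) / z"
proof -
  have "z \<noteq> 0" using assms by (metis exp_not_eq_zero)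
  moreover have "exp (exp (L z) * of_real t + of_real (\<alpha> - \<beta> + 1) * L z)
      = exp (exp (L z) * of_real t) * exp (of_real (\<alpha> - \<beta>) * L z) * exp (L z)"
    by (simp add: exp_add distrib_right)
  ultimately show ?thesis
    using assms by (simp add: integrand_def log_integrand_def)
qed

lemma open_strip: "open {w. \<bar>Im w\<bar> < \<eta>}"
  by (intro open_Collect_less continuous_intros)

lemma convex_strip: "convex {w. \<bar>Im w\<bar> < \<eta>}"
proof -
  have "{w. \<bar>Im w\<bar> < \<eta>} = {w. Im w < \<eta>} \<inter> {w. Im w > - \<eta>}" by auto
  then show ?thesis
    using convex_Int[OF convex_halfspace_Im_lt convex_halfspace_Im_gt] by metis
qed

text \<open>If there is no branch root, the residue is 0 and z0 is arbitrary.\<close>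

lemma log_integrand_pole:
  assumes "0 < \<alpha>" "\<alpha> < 1" "\<bar>Arg l\<bar> \<noteq> \<alpha> * pi"
    and z0: "z0 \<notin> \<real>\<^sub>\<le>\<^sub>0" "\<And>z. is_branch_root \<alpha> l z \<Longrightarrow> z = z0"
  obtains \<eta> H where "\<eta> > pi" "H holomorphic_on {w. \<bar>Im w\<bar> < \<eta>}"
    "\<And>w. \<bar>Im w\<bar> < \<eta> \<Longrightarrow> w \<noteq> Ln z0 \<Longrightarrow> exp (of_real \<alpha> * w) \<noteq> l"
    "\<And>w. \<bar>Im w\<bar> < \<eta> \<Longrightarrow> w \<noteq> Ln z0 \<Longrightarrow>
       log_integrand t \<alpha> \<beta> l w = branch_residue t \<alpha> \<beta> l / (w - Ln z0) + H w"
proof -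
  obtain \<eta> where "\<eta> > pi"
    and \<eta>: "\<And>w. \<bar>Im w\<bar> < \<eta> \<Longrightarrow> exp (of_real \<alpha> * w) = l \<Longrightarrow> \<bar>Im w\<bar> < pi"
    using exp_eq_on_strip[OF assms(1-3)] by blast
  let ?S = "{w. \<bar>Im w\<bar> < \<eta>}"
  have root: "is_branch_root \<alpha> l (exp w) \<and> w = Ln z0" if "\<bar>Im w\<bar> < \<eta>" "exp (of_real \<alpha> * w) = l" for w
  proof -
    have Im: "\<bar>Im w\<bar> < pi" using \<eta> that by blast
    then have r: "is_branch_root \<alpha> l (exp w)" using that by (simp add: is_branch_root_exp_iff)
    then have "exp w = z0" using z0(2) by blast
    moreover have "Ln (exp w) = w" using Im by (intro Ln_exp) auto
    ultimately show ?thesis using r by simp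
  qed
  define f where "f = (\<lambda>w. exp (exp w * complex_of_real t + of_real (\<alpha> - \<beta> + 1) * w))"
  define g where "g = (\<lambda>w. exp (complex_of_real \<alpha> * w) - l)"
  have fg: "log_integrand t \<alpha> \<beta> l w = f w / g w" for w
    by (simp add: log_integrand_def f_def g_def)
  have hol: "f holomorphic_on ?S" "g holomorphic_on ?S"
    unfolding f_def g_def by (intro holomorphic_intros)+
  have gnz: "g w \<noteq> 0" if "w \<in> ?S" "w \<noteq> Ln z0" for w
  proof
    assume "g w = 0"
    then have "exp (of_real \<alpha> * w) = l" by (simp add: g_def)
    then show False using root[of w] that by blast
  qed
  show ?thesis
  proof (cases "\<exists>z. is_branch_root \<alpha> l z")
    case False
    have nz: "exp (of_real \<alpha> * w) \<noteq> l" if "\<bar>Im w\<bar> < \<eta>" for w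
      using root[OF that] False by blast
    show ?thesis
    proof (rule that[OF \<open>\<eta> > pi\<close>])
      show "log_integrand t \<alpha> \<beta> l holomorphic_on ?S"
        unfolding log_integrand_def using nz by (intro holomorphic_intros) auto
      show "log_integrand t \<alpha> \<beta> l w = branch_residue t \<alpha> \<beta> l / (w - Ln z0) + log_integrand t \<alpha> \<beta> l w" for w
        using False by (simp add: branch_residue_def)
    qed (use nz in blast)
  next
    case True
    then have rt: "is_branch_root \<alpha> l z0" using z0(2) by blast
    have nz: "z0 \<noteq> 0" using z0(1) by auto
    have e0: "exp (of_real \<alpha> * Ln z0) = l" 
      using rt nz by (simp add: is_branch_root_def powr_def)
    then have "l \<noteq> 0" by auto
    have dg: "(g has_field_derivative of_real \<alpha> * l) (at (Ln z0))"
      unfolding g_def using e0 by (auto intro!: derivative_eq_intros)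
    have mem: "Ln z0 \<in> ?S" using abs_Im_Ln_less_pi[OF z0(1)] \<open>\<eta> > pi\<close> by simp
    obtain h where h: "h holomorphic_on ?S"
      "\<And>w. w \<in> ?S \<Longrightarrow> w \<noteq> Ln z0 \<Longrightarrow> f w / g w = (f (Ln z0) / (of_real \<alpha> * l)) / (w - Ln z0) + h w"
    proof (rule simple_pole_split[OF open_strip hol mem _ dg])
      show "g (Ln z0) = 0" using e0 by (simp add: g_def)
      show "of_real \<alpha> * l \<noteq> 0" using \<open>l \<noteq> 0\<close> assms(1) by simp
    qed (use gnz in auto)
    have "(THE z. is_branch_root \<alpha> l z) = z0"
      using rt z0(2) by blast
    then have "branch_residue t \<alpha> \<beta> l = residue (integrand t \<alpha> \<beta> l ln) z0"
      using True by (simp add: branch_residue_def)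
    also have "\<dots> = residue (\<lambda>z. exp (z * of_real t) * exp (of_real (\<alpha> - \<beta>) * ln z) / (exp (of_real \<alpha> * ln z) - l)) z0"
      by (simp add: integrand_def[abs_def])
    also have "\<dots> = exp (z0 * of_real t) * exp (of_real (\<alpha> - \<beta>) * ln z0) / (of_real \<alpha> * l / z0)"
    proof (rule residue_simple_pole_deriv)
      let ?T = "- (of_real ` {..0}) :: complex set"
      have T: "z \<in> ?T \<longleftrightarrow> z \<notin> \<real>\<^sub>\<le>\<^sub>0" for z :: complex
        by (auto simp: nonpos_Reals_def)
      show "(\<lambda>z. exp (z * of_real t) * exp (of_real (\<alpha> - \<beta>) * ln z)) holomorphic_on ?T"
        "(\<lambda>z. exp (of_real \<alpha> * ln z) - l) holomorphic_on ?T"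
        using T by (auto intro!: holomorphic_intros)
      have "?T = - \<real>\<^sub>\<le>\<^sub>0" using T by auto
      then show "open ?T" by (simp add: open_Compl)
      show "connected ?T"
        using starlike_slotted_complex_plane_left[of 0] by (intro starlike_imp_connected) auto
      show "z0 \<in> ?T" using T z0 by simp
      show "((\<lambda>z. exp (of_real \<alpha> * ln z) - l) has_field_derivative of_real \<alpha> * l / z0) (at z0)"
        using z0(1) e0 by (auto intro!: derivative_eq_intros simp: field_simps)
      show "exp (of_real \<alpha> * ln z0) - l = 0" using e0 by simp
      show "of_real \<alpha> * l / z0 \<noteq> 0" using \<open>l \<noteq> 0\<close> assms(1) nz by simp
    qed auto
    \<comment> \<open>The derivative of z^alpha at the root is alpha l / z0 in z, but alpha l in w.
      The extra factor z0 is the dz/dw contained in \<open>f\<close>, so both coordinates give the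
      same residue.\<close>
    also have "\<dots> = f (Ln z0) / (of_real \<alpha> * l)"
      using nz by (simp add: f_def exp_add distrib_right)
    finally have "f (Ln z0) / (of_real \<alpha> * l) = branch_residue t \<alpha> \<beta> l" ..
    then show ?thesis
      using that[OF \<open>\<eta> > pi\<close> h(1)] h(2) gnz fg by (simp add: g_def)
  qed
qed

text \<open>In this form the singular part becomes C / (z - z0), without logarithm, in the variable z.\<close>

lemma log_integrand_pole_exp:
  assumes "0 < \<alpha>" "\<alpha> < 1" "\<bar>Arg l\<bar> \<noteq> \<alpha> * pi"
    and z0: "z0 \<notin> \<real>\<^sub>\<le>\<^sub>0" "\<And>z. is_branch_root \<alpha> l z \<Longrightarrow> z = z0"
  obtains \<eta> H where "\<eta> > pi" "H holomorphic_on {w. \<bar>Im w\<bar> < \<eta>}"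
    "\<And>w. \<bar>Im w\<bar> < \<eta> \<Longrightarrow> w \<noteq> Ln z0 \<Longrightarrow>
       log_integrand t \<alpha> \<beta> l w = branch_residue t \<alpha> \<beta> l * exp w / (exp w - z0) + H w"
proof -
  obtain \<eta> H where H: "\<eta> > pi" "H holomorphic_on {w. \<bar>Im w\<bar> < \<eta>}"
    "\<And>w. \<bar>Im w\<bar> < \<eta> \<Longrightarrow> w \<noteq> Ln z0 \<Longrightarrow>
       log_integrand t \<alpha> \<beta> l w = branch_residue t \<alpha> \<beta> l / (w - Ln z0) + H w"
    using log_integrand_pole[OF assms] by metis
  \<comment> \<open>The strip must omit the other logarithms Ln z0 + 2 n pi i of z0. This bound
    keeps |Im w - Im (Ln z0)| below 2 pi and is still larger than pi, since |Im (Ln z0)| <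
    pi.\<close>
  define \<eta>' where "\<eta>' = min \<eta> (2 * pi - \<bar>Im (Ln z0)\<bar>)"
  let ?S = "{w. \<bar>Im w\<bar> < \<eta>'}"
  have Im0: "\<bar>Im (Ln z0)\<bar> < pi" using abs_Im_Ln_less_pi[OF z0(1)] .
  have nz: "z0 \<noteq> 0" using z0(1) by auto
  have "\<eta>' > pi" using H(1) Im0 by (simp add: \<eta>'_def)
  obtain h where h: "h holomorphic_on ?S"
    "\<And>w. w \<in> ?S \<Longrightarrow> w \<noteq> Ln z0 \<Longrightarrow> exp w / (exp w - z0) = (exp (Ln z0) / z0) / (w - Ln z0) + h w"
  proof (rule simple_pole_split[OF open_strip, of exp \<eta>' "\<lambda>w. exp w - z0" "Ln z0" z0])
    show "((\<lambda>w. exp w - z0) has_field_derivative z0) (at (Ln z0))"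
      using nz by (auto intro!: derivative_eq_intros)
    show "exp w - z0 \<noteq> 0" if "w \<in> ?S" "w \<noteq> Ln z0" for w
    proof
      assume "exp w - z0 = 0"
      then have "exp w = exp (Ln z0)" using nz by simp
      then have "w = Ln z0"
        by (rule exp_complex_eqI[rotated]) (use that(1) in \<open>auto simp: \<eta>'_def\<close>)
      then show False using that(2) by simp
    qed
  qed (use nz Im0 \<open>\<eta>' > pi\<close> in \<open>auto intro!: holomorphic_intros\<close>)
  show ?thesis
  proof (rule that[OF \<open>\<eta>' > pi\<close>])
    show "(\<lambda>w. H w - branch_residue t \<alpha> \<beta> l * h w) holomorphic_on ?S"
      using H(2) h(1) by (intro holomorphic_intros) (auto elim!: holomorphic_on_subset simp: \<eta>'_def)
    show "log_integrand t \<alpha> \<beta> l w = branch_residue t \<alpha> \<beta> l * exp w / (exp w - z0)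
        + (H w - branch_residue t \<alpha> \<beta> l * h w)" if "\<bar>Im w\<bar> < \<eta>'" "w \<noteq> Ln z0" for w
    proof -
      have "exp w / (exp w - z0) = 1 / (w - Ln z0) + h w"
        using h(2)[of w] that nz by simp
      then have "branch_residue t \<alpha> \<beta> l * (exp w / (exp w - z0))
          = branch_residue t \<alpha> \<beta> l * (1 / (w - Ln z0) + h w)" by simp
      moreover have "\<bar>Im w\<bar> < \<eta>" using that(1) by (simp add: \<eta>'_def)
      ultimately show ?thesis
        using H(3)[of w] that(2) by (simp add: distrib_left)
    qed
  qed
qed

section \<open>The closed contour\<close>

text \<open>The cut is a boundary of the closed upper half-plane, so only a derivative within that
  set exists there. A quarter turn by - i moves the set into the right half-plane, away from the cut
  of \<open>Ln\<close>, and the added i pi / 2 restores the value.\<close>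

lemma has_field_derivative_Ln_upper:
  assumes "z \<in> {z. 0 \<le> Im z} - {0}"
  shows "(Ln has_field_derivative 1 / z) (at z within {z. 0 \<le> Im z} - {0})"
proof (rule has_field_derivative_transform_within[OF _ zero_less_one assms])
  show "Ln (- \<i> * x) + \<i> * of_real pi / 2 = Ln x" if "x \<in> {z. 0 \<le> Im z} - {0}" for x
    using Ln_times_ii[of "- \<i> * x"] that by simp
  show "((\<lambda>x. Ln (- \<i> * x) + \<i> * of_real pi / 2) has_field_derivative 1 / z) (at z within {z. 0 \<le> Im z} - {0})"
    using assms by (auto intro!: derivative_eq_intros simp: complex_nonpos_Reals_iff complex_eq_iff[of z 0] inverse_eq_divide)
qed

text \<open>Mirror image: here the quarter turn is by i, and subtracting i pi / 2 produces the
  boundary value with imaginary part - pi.\<close>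

lemma has_field_derivative_Ln_lower:
  assumes "z \<in> {z. Im z \<le> 0} - {0}"
  shows "(Ln_lower has_field_derivative 1 / z) (at z within {z. Im z \<le> 0} - {0})"
proof (rule has_field_derivative_transform_within[OF _ zero_less_one assms])
  show "Ln (\<i> * x) - \<i> * of_real pi / 2 = Ln_lower x" if "x \<in> {z. Im z \<le> 0} - {0}" for x
    using Ln_times_ii[of x] that
    by (auto simp: Ln_lower_def complex_nonpos_Reals_iff complex_eq_iff)
  show "((\<lambda>x. Ln (\<i> * x) - \<i> * of_real pi / 2) has_field_derivative 1 / z) (at z within {z. Im z \<le> 0} - {0})"
    using assms by (auto intro!: derivative_eq_intros simp: complex_nonpos_Reals_iff complex_eq_iff[of z 0] inverse_eq_divide)
qed

lemma abs_Im_Ln_le: "z \<noteq> 0 \<Longrightarrow> \<bar>Im (Ln z)\<bar> \<le> pi"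
  using mpi_less_Im_Ln[of z] Im_Ln_le_pi[of z] by linarith

lemma exp_Ln_lower: "z \<noteq> 0 \<Longrightarrow> exp (Ln_lower z) = z"
  by (auto simp: Ln_lower_def exp_diff exp_two_pi_i')

lemma abs_Im_Ln_lower_le: 
  assumes "z \<noteq> 0" shows "\<bar>Im (Ln_lower z)\<bar> \<le> pi"
proof (cases "z \<in> \<real>\<^sub>\<le>\<^sub>0")
  case True
  then have "Re z < 0" "Im z = 0" using assms by (auto simp: complex_nonpos_Reals_iff complex_eq_iff)
  then have "Im (Ln z) = pi" using Im_Ln_eq_pi[OF assms] by simp
  then show ?thesis using True by (simp add: Ln_lower_def)
next
  case False
  then show ?thesis using abs_Im_Ln_le[OF assms] by (simp add: Ln_lower_def)
qed

text \<open>Separates what depends on the branch, an increment of P (L z), from what does not, the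
  integral of 1 / (z - z0). The set \<open>S\<close> need not be open: it will be a closed
  half-plane without 0 for the pieces that touch the cut, and the slit plane for FA.\<close>

lemma contour_integral_integrand_piece:
  assumes P: "\<forall>w. \<bar>Im w\<bar> < \<eta> \<longrightarrow> (P has_field_derivative H w) (at w)" and "\<eta> > pi"
    and decomp: "\<forall>w. \<bar>Im w\<bar> < \<eta> \<longrightarrow> w \<noteq> Ln z0 \<longrightarrow>
       log_integrand t \<alpha> \<beta> l w = C * exp w / (exp w - z0) + H w"
    and "z0 \<noteq> 0"
    and L: "\<forall>z\<in>S. (L has_field_derivative 1 / z) (at z within S)"
      "\<forall>z\<in>S. exp (L z) = z" "\<forall>z\<in>S. \<bar>Im (L z)\<bar> \<le> pi"
    and \<gamma>: "valid_path \<gamma>" "path_image \<gamma> \<subseteq> S" "z0 \<notin> path_image \<gamma>"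
  shows "contour_integral \<gamma> (integrand t \<alpha> \<beta> l L)
    = P (L (pathfinish \<gamma>)) - P (L (pathstart \<gamma>)) + C * contour_integral \<gamma> (\<lambda>z. 1 / (z - z0))"
proof (rule contour_integral_unique)
  have "((\<lambda>z. H (L z) * (1 / z)) has_contour_integral P (L (pathfinish \<gamma>)) - P (L (pathstart \<gamma>))) \<gamma>"
  proof (rule contour_integral_primitive[OF _ \<gamma>(1,2), where f = "\<lambda>z. P (L z)"])
    fix z assume "z \<in> S"
    then have "(P has_field_derivative H (L z)) (at (L z))"
      using L(3) P \<open>\<eta> > pi\<close> by force
    then show "((\<lambda>z. P (L z)) has_field_derivative H (L z) * (1 / z)) (at z within S)"
      using L(1) \<open>z \<in> S\<close> by (blast intro: DERIV_chain2)
  qed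
  moreover have "(\<lambda>z. 1 / (z - z0)) contour_integrable_on \<gamma>"
    by (rule contour_integrable_holomorphic_simple[of _ "- {z0}"])
      (use \<gamma> in \<open>auto intro!: holomorphic_intros\<close>)
  then have "((\<lambda>z. C * (1 / (z - z0))) has_contour_integral C * contour_integral \<gamma> (\<lambda>z. 1 / (z - z0))) \<gamma>"
    by (intro has_contour_integral_lmul has_contour_integral_integral)
  ultimately have "((\<lambda>z. H (L z) * (1 / z) + C * (1 / (z - z0))) has_contour_integral
      P (L (pathfinish \<gamma>)) - P (L (pathstart \<gamma>)) + C * contour_integral \<gamma> (\<lambda>z. 1 / (z - z0))) \<gamma>"
    by (rule has_contour_integral_add)
  then show "(integrand t \<alpha> \<beta> l L has_contour_integral
      P (L (pathfinish \<gamma>)) - P (L (pathstart \<gamma>)) + C * contour_integral \<gamma> (\<lambda>z. 1 / (z - z0))) \<gamma>"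
  proof (rule has_contour_integral_eq)
    fix z assume z: "z \<in> path_image \<gamma>"
    then have zS: "z \<in> S" "z \<noteq> z0" using \<gamma> by auto
    then have Lz: "exp (L z) = z" "\<bar>Im (L z)\<bar> < \<eta>" using L(2,3) \<open>\<eta> > pi\<close> by force+
    then have "L z \<noteq> Ln z0" using \<open>z0 \<noteq> 0\<close> zS by auto
    then have "log_integrand t \<alpha> \<beta> l (L z) = C * z / (z - z0) + H (L z)"
      using decomp Lz by auto
    moreover have "z \<noteq> 0" using Lz by (metis exp_not_eq_zero)
    ultimately show "H (L z) * (1 / z) + C * (1 / (z - z0)) = integrand t \<alpha> \<beta> l L z"
      using integrand_eq_log_integrand[of L z, OF Lz(1)] by (simp add: add_divide_distrib)
  qed
qed

lemma Ln_of_real_times_cis: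
  assumes "0 < \<rho>" "- pi < \<theta>" "\<theta> \<le> pi"
  shows "Ln (of_real \<rho> * cis \<theta>) = of_real (ln \<rho>) + \<i> * of_real \<theta>"
proof (rule Ln_unique)
  have "exp (complex_of_real (ln \<rho>)) = of_real \<rho>"
    using assms(1) by (metis exp_ln exp_of_real)
  then show "exp (of_real (ln \<rho>) + \<i> * of_real \<theta>) = of_real \<rho> * cis \<theta>"
    by (simp add: exp_add cis_conv_exp)
qed (use assms in auto)

text \<open>This circle meets the cut at both ends, where \<open>ln\<close> takes the same value, so
  no set \<open>S\<close> as for the other pieces contains it. It is instead parametrised by its
  angle, along which w = ln rho + i theta is smooth. The pole term vanishes because z0 lies outside
  the circle.\<close>

lemma contour_integral_integrand_circle:
  assumes P: "\<forall>w. \<bar>Im w\<bar> < \<eta> \<longrightarrow> (P has_field_derivative H w) (at w)" and "\<eta> > pi"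
    and decomp: "\<forall>w. \<bar>Im w\<bar> < \<eta> \<longrightarrow> w \<noteq> Ln z0 \<longrightarrow>
       log_integrand t \<alpha> \<beta> l w = C * exp w / (exp w - z0) + H w"
    and \<rho>: "0 < \<rho>" "\<rho> < cmod z0"
  shows "contour_integral (part_circlepath 0 \<rho> pi (- pi)) (integrand t \<alpha> \<beta> l ln)
    = P (of_real (ln \<rho>) - \<i> * of_real pi) - P (of_real (ln \<rho>) + \<i> * of_real pi)"
proof -
  define w where "w = (\<lambda>\<theta>. complex_of_real (ln \<rho>) + \<i> * of_real \<theta>)"
  have "((\<lambda>\<theta>. P (w \<theta>)) has_vector_derivative \<i> * H (w \<theta>)) (at \<theta> within {-pi..pi})" if "\<theta> \<in> {-pi..pi}" for \<theta>
  proof -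
    have "(w has_vector_derivative \<i>) (at \<theta> within {-pi..pi})"
      unfolding w_def by (auto intro!: derivative_eq_intros)
    moreover have "(P has_field_derivative H (w \<theta>)) (at (w \<theta>))"
      using that P \<open>\<eta> > pi\<close> by (auto simp: w_def)
    ultimately show ?thesis
      using field_vector_diff_chain_within[of w \<i> \<theta> "{-pi..pi}" P]
      by (simp add: o_def has_field_derivative_at_within)
  qed
  then have I1: "((\<lambda>\<theta>. \<i> * H (w \<theta>)) has_integral (P (w pi) - P (w (- pi)))) {-pi..pi}"
    by (intro fundamental_theorem_of_calculus) auto
  have "((\<lambda>z. 1 / (z - z0)) has_contour_integral 0) (part_circlepath 0 \<rho> (- pi) pi)"
  proof (rule Cauchy_theorem_convex_simple[of _ "ball 0 (cmod z0)"])
    show "(\<lambda>z. 1 / (z - z0)) holomorphic_on ball 0 (cmod z0)"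
      by (intro holomorphic_intros) auto
    show "path_image (part_circlepath 0 \<rho> (- pi) pi) \<subseteq> ball 0 (cmod z0)"
      using path_image_part_circlepath_subset'[of \<rho> 0 "-pi" pi] \<rho> by (auto simp: sphere_def)
    show "pathfinish (part_circlepath 0 \<rho> (- pi) pi) = pathstart (part_circlepath 0 \<rho> (- pi) pi)"
      by (simp add: exp_minus)
  qed auto
  then have "((\<lambda>\<theta>. 1 / (0 + of_real \<rho> * cis \<theta> - z0) * of_real \<rho> * \<i> * cis \<theta>) has_integral 0) {-pi..pi}"
    by (subst (asm) has_contour_integral_part_circlepath_iff) auto
  then have "((\<lambda>\<theta>. C * (1 / (0 + of_real \<rho> * cis \<theta> - z0) * of_real \<rho> * \<i> * cis \<theta>)) has_integral C * 0) {-pi..pi}"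
    by (rule has_integral_mult_right)
  from has_integral_add[OF I1 this]
  have "((\<lambda>\<theta>. \<i> * H (w \<theta>) + C * (1 / (0 + of_real \<rho> * cis \<theta> - z0) * of_real \<rho> * \<i> * cis \<theta>))
      has_integral (P (w pi) - P (w (- pi)))) {-pi..pi}" by simp
  then have "((\<lambda>\<theta>. integrand t \<alpha> \<beta> l ln (0 + of_real \<rho> * cis \<theta>) * of_real \<rho> * \<i> * cis \<theta>)
      has_integral (P (w pi) - P (w (- pi)))) {-pi..pi}"
  \<comment> \<open>At theta = - pi the principal logarithm jumps back to imaginary part pi; this
    single parameter value is discarded.\<close>
  proof (rule has_integral_spike[of "{- pi}", rotated 2])
    fix \<theta> assume \<theta>: "\<theta> \<in> {- pi..pi} - {- pi}"
    then have Ln: "Ln (of_real \<rho> * cis \<theta>) = w \<theta>"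
      unfolding w_def by (intro Ln_of_real_times_cis \<rho>(1)) auto
    have nz: "of_real \<rho> * cis \<theta> \<noteq> 0" using \<rho> by simp
    have ex: "exp (w \<theta>) = of_real \<rho> * cis \<theta>" using exp_Ln[OF nz] Ln by simp
    have ne: "of_real \<rho> * cis \<theta> \<noteq> z0"
    proof
      assume "of_real \<rho> * cis \<theta> = z0"
      then have "cmod (of_real \<rho> * cis \<theta>) = cmod z0" by (rule arg_cong)
      then show False using \<rho> by (simp add: norm_mult)
    qed
    moreover have "z0 \<noteq> 0" using \<rho> by auto
    ultimately have "w \<theta> \<noteq> Ln z0" using ex by auto
    then have "log_integrand t \<alpha> \<beta> l (w \<theta>) = C * exp (w \<theta>) / (exp (w \<theta>) - z0) + H (w \<theta>)"
      using \<theta> \<open>\<eta> > pi\<close> decomp by (auto simp: w_def)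
    moreover have "integrand t \<alpha> \<beta> l ln (of_real \<rho> * cis \<theta>) = log_integrand t \<alpha> \<beta> l (w \<theta>) / (of_real \<rho> * cis \<theta>)"
      using nz Ln ex by (subst integrand_eq_log_integrand) auto
    ultimately have k: "integrand t \<alpha> \<beta> l ln (of_real \<rho> * cis \<theta>) * (of_real \<rho> * cis \<theta>)
        = C * (of_real \<rho> * cis \<theta>) / (of_real \<rho> * cis \<theta> - z0) + H (w \<theta>)"
      using nz ex by simp
    have "integrand t \<alpha> \<beta> l ln (0 + of_real \<rho> * cis \<theta>) * of_real \<rho> * \<i> * cis \<theta>
      = \<i> * (integrand t \<alpha> \<beta> l ln (of_real \<rho> * cis \<theta>) * (of_real \<rho> * cis \<theta>))"
      by (simp add: mult_ac)
    then show "integrand t \<alpha> \<beta> l ln (0 + of_real \<rho> * cis \<theta>) * of_real \<rho> * \<i> * cis \<theta>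
      = \<i> * H (w \<theta>) + C * (1 / (0 + of_real \<rho> * cis \<theta> - z0) * of_real \<rho> * \<i> * cis \<theta>)"
      unfolding k by (simp add: distrib_left mult_ac)
  qed auto
  then have "(integrand t \<alpha> \<beta> l ln has_contour_integral (P (w pi) - P (w (- pi)))) (part_circlepath 0 \<rho> (- pi) pi)"
    by (subst has_contour_integral_part_circlepath_iff) auto
  from has_contour_integral_reversepath[OF _ this]
  have "(integrand t \<alpha> \<beta> l ln has_contour_integral - (P (w pi) - P (w (- pi)))) (part_circlepath 0 \<rho> pi (- pi))"
    by simp
  then show ?thesis
    by (simp add: contour_integral_unique w_def)
qed

lemma Ln_of_neg_real:
  assumes "0 < x"
  shows "Ln (- of_real x) = of_real (ln x) + \<i> * of_real pi"
    "Ln_lower (- of_real x) = of_real (ln x) - \<i> * of_real pi"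
proof -
  show "Ln (- of_real x) = of_real (ln x) + \<i> * of_real pi"
    using Ln_of_real_times_cis[OF assms, of pi] by simp
  moreover have "- complex_of_real x \<in> \<real>\<^sub>\<le>\<^sub>0" using assms by (simp add: complex_nonpos_Reals_iff)
  ultimately show "Ln_lower (- of_real x) = of_real (ln x) - \<i> * of_real pi"
    by (simp add: Ln_lower_def)
qed

text \<open>Two primitives are used: Ln (z0 - z), cut along the ray from z0 to the right, on the
  arcs, and Ln (z - z0), cut along the ray to the left, on the segment. At the two corners they
  differ by i pi and - i pi, which adds up to 2 pi i.\<close>

lemma winding_half_disc:
  assumes "Re z0 < c" "cmod (z0 - of_real c) < R"
  defines "f \<equiv> \<lambda>z. 1 / (z - z0)"
  shows "contour_integral (part_circlepath (of_real c) (- R) (- (pi / 2)) 0) f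
   + contour_integral (part_circlepath (of_real c) (- R) 0 (pi / 2)) f
   + contour_integral (linepath (of_real c - \<i> * of_real R) (of_real c + \<i> * of_real R)) f = 2 * of_real pi * \<i>"
proof -
  have "0 < R" using assms(2) norm_ge_zero[of "z0 - of_real c"] by linarith
  have Im0: "\<bar>Im z0\<bar> < R" using assms(2) abs_Im_le_cmod[of "z0 - of_real c"] by simp
  let ?S = "{z. z0 - z \<notin> \<real>\<^sub>\<le>\<^sub>0}"
  have S: "of_real c + - R * exp (\<i> * of_real \<theta>) \<in> ?S" if "\<bar>\<theta>\<bar> \<le> pi / 2" for \<theta>
  proof (rule ccontr)
    define z where "z = of_real c + - R * exp (\<i> * of_real \<theta>)"
    assume "\<not> ?thesis"
    then have 1: "Re z0 \<le> Re z" "Im z = Im z0" by (auto simp: z_def complex_nonpos_Reals_iff)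
    have "cos \<theta> \<ge> 0" using that by (intro cos_ge_zero) auto
    then have "Re z \<le> c" using \<open>0 < R\<close> by (simp add: z_def exp_Euler cos_of_real sin_of_real)
    \<comment> \<open>A point on the ray to the right of z0 whose real part is at most c is no
      farther from the centre than z0, hence not on the arc.\<close>
    then have "(Re z - c)\<^sup>2 \<le> (Re z0 - c)\<^sup>2" using 1 by (simp add: abs_le_square_iff[symmetric])
    then have "cmod (z - of_real c) \<le> cmod (z0 - of_real c)"
      using 1 by (simp add: cmod_def)
    moreover have "cmod (z - of_real c) = R" using \<open>0 < R\<close> by (simp add: z_def norm_mult)
    ultimately show False using assms(2) by simp
  qed
  have arc: "contour_integral (part_circlepath (of_real c) (- R) a b) f
    = Ln (z0 - (of_real c - R * exp (\<i> * of_real b))) - Ln (z0 - (of_real c - R * exp (\<i> * of_real a)))"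
    if "- (pi / 2) \<le> a" "a \<le> b" "b \<le> pi / 2" for a b
  proof -
    have "(f has_contour_integral (Ln (z0 - pathfinish (part_circlepath (of_real c) (- R) a b))
       - Ln (z0 - pathstart (part_circlepath (of_real c) (- R) a b)))) (part_circlepath (of_real c) (- R) a b)"
    proof (rule contour_integral_primitive[where S = ?S and f = "\<lambda>z. Ln (z0 - z)"])
      show "((\<lambda>z. Ln (z0 - z)) has_field_derivative f z) (at z within ?S)" if "z \<in> ?S" for z
      proof -
        have "((\<lambda>z. Ln (z0 - z)) has_field_derivative inverse (z0 - z) * (- 1)) (at z within ?S)"
          using that by (auto intro!: derivative_eq_intros)
        moreover have "inverse (z0 - z) * (- 1) = f z"
          by (metis f_def inverse_eq_divide minus_diff_eq mult_minus1_right nonzero_inverse_minus_eq divide_minus_left minus_divide_right)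
        ultimately show ?thesis by simp
      qed
      show "path_image (part_circlepath (of_real c) (- R) a b) \<subseteq> ?S"
        using that S by (auto simp: path_image_part_circlepath)
    qed auto
    then show ?thesis by (simp add: contour_integral_unique)
  qed
  have seg: "contour_integral (linepath (of_real c - \<i> * of_real R) (of_real c + \<i> * of_real R)) f
    = Ln (of_real c + \<i> * of_real R - z0) - Ln (of_real c - \<i> * of_real R - z0)"
  proof (rule contour_integral_unique)
    let ?l = "linepath (of_real c - \<i> * of_real R) (of_real c + \<i> * of_real R)"
    have "(f has_contour_integral (Ln (pathfinish ?l - z0) - Ln (pathstart ?l - z0))) ?l"
    proof (rule contour_integral_primitive[where S = "{z. z - z0 \<notin> \<real>\<^sub>\<le>\<^sub>0}" and f = "\<lambda>z. Ln (z - z0)"])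
      show "((\<lambda>z. Ln (z - z0)) has_field_derivative f z) (at z within {z. z - z0 \<notin> \<real>\<^sub>\<le>\<^sub>0})"
        if "z \<in> {z. z - z0 \<notin> \<real>\<^sub>\<le>\<^sub>0}" for z
        using that by (auto intro!: derivative_eq_intros simp: f_def inverse_eq_divide)
      show "path_image ?l \<subseteq> {z. z - z0 \<notin> \<real>\<^sub>\<le>\<^sub>0}"
        using assms(1) by (auto simp: complex_nonpos_Reals_iff closed_segment_same_Re)
    qed auto
    then show "(f has_contour_integral Ln (of_real c + \<i> * of_real R - z0) - Ln (of_real c - \<i> * of_real R - z0)) ?l"
      by simp
  qed
  have e: "exp (\<i> * of_real (pi / 2)) = \<i>" "exp (\<i> * of_real (- (pi / 2))) = - \<i>"
    by (simp_all add: complex_eq_iff Re_exp Im_exp)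
  define A where "A = of_real c + \<i> * of_real R - z0"
  define B where "B = of_real c - \<i> * of_real R - z0"
  have nz: "A \<noteq> 0" "B \<noteq> 0" "Im A > 0" "Im B < 0" using Im0 by (auto simp: A_def B_def complex_eq_iff)
  have "Ln (- A) = Ln A - \<i> * pi" "Ln (- B) = Ln B + \<i> * pi"
    using nz by (subst Ln_minus; simp)+
  moreover have "z0 - (of_real c - R * exp (\<i> * of_real (pi / 2))) = - B"
    "z0 - (of_real c - R * exp (\<i> * of_real (- (pi / 2)))) = - A"
    unfolding e A_def B_def by (simp_all add: algebra_simps)
  ultimately have "contour_integral (part_circlepath (of_real c) (- R) (- (pi / 2)) 0) f
   + contour_integral (part_circlepath (of_real c) (- R) 0 (pi / 2)) f = Ln B + \<i> * pi - (Ln A - \<i> * pi)"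
    by (subst (1 2) arc) (use pi_ge_zero in \<open>simp_all\<close>)
  then show ?thesis
    by (simp add: seg A_def B_def)
qed

lemma cut_contour_integral_eq_residue:
  assumes \<alpha>: "0 < \<alpha>" "\<alpha> < 1" "\<bar>Arg l\<bar> \<noteq> \<alpha> * pi"
    and z0: "z0 \<notin> \<real>\<^sub>\<le>\<^sub>0" "\<And>z. is_branch_root \<alpha> l z \<Longrightarrow> z = z0"
    and c: "0 < c" "c < R" "Re z0 < c" "cmod (z0 - of_real c) < R"
    and \<rho>: "0 < \<rho>" "\<rho> < R - c" "\<rho> < cmod z0"
  shows "cut_contour_integral c R \<rho> (integrand t \<alpha> \<beta> l) = 2 * of_real pi * \<i> * branch_residue t \<alpha> \<beta> l"
proof -
  define C where "C = branch_residue t \<alpha> \<beta> l"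
  obtain \<eta> H where H: "\<eta> > pi" "H holomorphic_on {w. \<bar>Im w\<bar> < \<eta>}"
    and decomp: "\<forall>w. \<bar>Im w\<bar> < \<eta> \<longrightarrow> w \<noteq> Ln z0 \<longrightarrow>
       log_integrand t \<alpha> \<beta> l w = C * exp w / (exp w - z0) + H w"
    using log_integrand_pole_exp[OF \<alpha> z0, of t \<beta>] unfolding C_def by blast
  obtain P where "\<And>w. w \<in> {w. \<bar>Im w\<bar> < \<eta>} \<Longrightarrow> (P has_field_derivative H w) (at w within {w. \<bar>Im w\<bar> < \<eta>})"
    using holomorphic_convex_primitive'[OF convex_strip open_strip H(2)] by blast
  then have P: "\<forall>w. \<bar>Im w\<bar> < \<eta> \<longrightarrow> (P has_field_derivative H w) (at w)"
    using at_within_open[OF _ open_strip] by (metis (no_types, lifting) mem_Collect_eq)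
  have nz: "z0 \<noteq> 0" using z0(1) by auto
  define f where "f = (\<lambda>z. 1 / (z - z0))"
  note piece = contour_integral_integrand_piece[OF P H(1) decomp nz, folded f_def]
  have upper: "contour_integral \<gamma> (integrand t \<alpha> \<beta> l ln)
      = P (ln (pathfinish \<gamma>)) - P (ln (pathstart \<gamma>)) + C * contour_integral \<gamma> f"
    if "valid_path \<gamma>" "path_image \<gamma> \<subseteq> {z. 0 \<le> Im z} - {0}" "z0 \<notin> path_image \<gamma>" for \<gamma>
    by (rule piece[OF _ _ _ that]) (use has_field_derivative_Ln_upper abs_Im_Ln_le in auto)
  have lower: "contour_integral \<gamma> (integrand t \<alpha> \<beta> l Ln_lower)
      = P (Ln_lower (pathfinish \<gamma>)) - P (Ln_lower (pathstart \<gamma>)) + C * contour_integral \<gamma> f"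
    if "valid_path \<gamma>" "path_image \<gamma> \<subseteq> {z. Im z \<le> 0} - {0}" "z0 \<notin> path_image \<gamma>" for \<gamma>
    by (rule piece[OF _ _ _ that]) (use has_field_derivative_Ln_lower abs_Im_Ln_lower_le exp_Ln_lower in auto)
  have right: "contour_integral \<gamma> (integrand t \<alpha> \<beta> l ln)
      = P (ln (pathfinish \<gamma>)) - P (ln (pathstart \<gamma>)) + C * contour_integral \<gamma> f"
    if "valid_path \<gamma>" "path_image \<gamma> \<subseteq> - \<real>\<^sub>\<le>\<^sub>0" "z0 \<notin> path_image \<gamma>" for \<gamma>
    by (rule piece[OF _ _ _ that])
      (auto intro!: derivative_eq_intros abs_Im_Ln_le exp_Ln simp: inverse_eq_divide)
  have arc_ne: "of_real c + of_real (- R) * exp (\<i> * of_real \<theta>) \<noteq> z0" for \<theta>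
  proof
    assume "of_real c + of_real (- R) * exp (\<i> * of_real \<theta>) = z0"
    then have "cmod (z0 - of_real c) = R" using c by (auto simp: norm_mult)
    then show False using c by simp
  qed
  have arc_Im: "of_real c + of_real (- R) * exp (\<i> * of_real \<theta>) = Complex (c - R * cos \<theta>) (- R * sin \<theta>)" for \<theta>
    by (simp add: complex_eq_iff exp_Euler cos_of_real sin_of_real)
  define X where "X = P (ln (complex_of_real (c - R)))"
  define X' where "X' = P (Ln_lower (complex_of_real (c - R)))"
  have e: "exp (\<i> * of_real (pi / 2)) = \<i>" "exp (\<i> * of_real (- (pi / 2))) = - \<i>"
    by (simp_all add: complex_eq_iff Re_exp Im_exp)
  have AB: "contour_integral (part_circlepath (of_real c) (- R) (- (pi / 2)) 0) (integrand t \<alpha> \<beta> l ln)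
     = X - P (ln (of_real c + \<i> * of_real R)) + C * contour_integral (part_circlepath (of_real c) (- R) (- (pi / 2)) 0) f"
  proof (subst upper)
    show "path_image (part_circlepath (of_real c) (- R) (- (pi / 2)) 0) \<subseteq> {z. 0 \<le> Im z} - {0}"
    proof
      fix z assume "z \<in> path_image (part_circlepath (of_real c) (- R) (- (pi / 2)) 0)"
      then obtain \<theta> where \<theta>: "z = Complex (c - R * cos \<theta>) (- R * sin \<theta>)" "- (pi / 2) \<le> \<theta>" "\<theta> \<le> 0"
        by (auto simp: path_image_part_circlepath arc_Im[simplified])
      have "sin \<theta> \<le> 0" using \<theta> sin_ge_zero[of "- \<theta>"] pi_ge_two by auto
      \<comment> \<open>To avoid the origin: the arc meets the real axis only at theta = 0, in the
        nonzero point c - R.\<close>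
      moreover have "sin \<theta> < 0" if "\<theta> \<noteq> 0" using \<theta> that sin_gt_zero[of "- \<theta>"] pi_ge_two by auto
      then have "Re z \<noteq> 0 \<or> Im z \<noteq> 0" using \<theta>(1) c by (cases "\<theta> = 0") auto
      ultimately show "z \<in> {z. 0 \<le> Im z} - {0}"
        using \<theta>(1) c by (auto simp: mult_le_0_iff complex_eq_iff)
    qed
    show "z0 \<notin> path_image (part_circlepath (of_real c) (- R) (- (pi / 2)) 0)"
      using arc_ne by (force simp: path_image_part_circlepath)
  qed (use e in \<open>simp_all add: X_def mult.commute\<close>)
  have EF: "contour_integral (part_circlepath (of_real c) (- R) 0 (pi / 2)) (integrand t \<alpha> \<beta> l Ln_lower)
     = P (ln (of_real c - \<i> * of_real R)) - X' + C * contour_integral (part_circlepath (of_real c) (- R) 0 (pi / 2)) f"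
  proof (subst lower)
    show "path_image (part_circlepath (of_real c) (- R) 0 (pi / 2)) \<subseteq> {z. Im z \<le> 0} - {0}"
    proof
      fix z assume "z \<in> path_image (part_circlepath (of_real c) (- R) 0 (pi / 2))"
      then obtain \<theta> where \<theta>: "z = Complex (c - R * cos \<theta>) (- R * sin \<theta>)" "\<theta> \<le> pi / 2" "\<theta> \<ge> 0"
        by (auto simp: path_image_part_circlepath arc_Im[simplified])
      have "sin \<theta> \<ge> 0" using \<theta> sin_ge_zero[of "\<theta>"] pi_ge_two by auto
      moreover have "sin \<theta> > 0" if "\<theta> \<noteq> 0" using \<theta> that sin_gt_zero[of "\<theta>"] pi_ge_two by auto
      then have "Re z \<noteq> 0 \<or> Im z \<noteq> 0" using \<theta>(1) c by (cases "\<theta> = 0") auto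
      ultimately show "z \<in> {z. Im z \<le> 0} - {0}"
        using \<theta>(1) c by (auto simp: complex_eq_iff)
    qed
    show "z0 \<notin> path_image (part_circlepath (of_real c) (- R) 0 (pi / 2))"
      using arc_ne by (force simp: path_image_part_circlepath)
    \<comment> \<open>EF starts on the cut with the lower logarithm and ends off it, where both
      logarithms agree; this matches the start of FA.\<close>
    have "of_real c - \<i> * of_real R \<notin> \<real>\<^sub>\<le>\<^sub>0" using c by (simp add: complex_nonpos_Reals_iff)
    then show "P (Ln_lower (pathfinish (part_circlepath (of_real c) (- R) 0 (pi / 2)))) - P (Ln_lower (pathstart (part_circlepath (of_real c) (- R) 0 (pi / 2)))) + C * contour_integral (part_circlepath (of_real c) (- R) 0 (pi / 2)) f
      = P (ln (of_real c - \<i> * of_real R)) - X' + C * contour_integral (part_circlepath (of_real c) (- R) 0 (pi / 2)) f"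
      using e by (simp add: X'_def Ln_lower_def mult.commute)
  qed simp
  have seg: "path_image (linepath (of_real (c - R)) (of_real (- \<rho>))) \<subseteq> {z. Im z = 0 \<and> Re z < 0}"
    "path_image (linepath (of_real (- \<rho>)) (of_real (c - R))) \<subseteq> {z. Im z = 0 \<and> Re z < 0}"
    using \<rho> c by (auto simp: closed_segment_same_Im closed_segment_eq_real_ivl)
  have z0': "\<not> (Im z0 = 0 \<and> Re z0 < 0)" using z0(1) by (auto simp: complex_nonpos_Reals_iff)
  have BC: "contour_integral (linepath (of_real (c - R)) (of_real (- \<rho>))) (integrand t \<alpha> \<beta> l ln)
     = P (ln (- of_real \<rho>)) - X + C * contour_integral (linepath (of_real (c - R)) (of_real (- \<rho>))) f"
    by (subst upper) (use seg(1) z0' in \<open>auto simp: X_def\<close>)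
  have DE: "contour_integral (linepath (of_real (- \<rho>)) (of_real (c - R))) (integrand t \<alpha> \<beta> l Ln_lower)
     = X' - P (Ln_lower (- of_real \<rho>)) + C * contour_integral (linepath (of_real (- \<rho>)) (of_real (c - R))) f"
    by (subst lower) (use seg(2) z0' in \<open>auto simp: X'_def\<close>)
  have BCDE: "contour_integral (linepath (of_real (- \<rho>)) (of_real (c - R))) f
      = - contour_integral (linepath (of_real (c - R)) (of_real (- \<rho>))) f"
    using contour_integral_reversepath[of "linepath (of_real (c - R)) (of_real (- \<rho>))" f] by simp
  \<comment> \<open>The small circle leads from the upper to the lower value of the logarithm at -
    rho, so it joins the telescoping sums of the two branches.\<close>
  have CD: "contour_integral (part_circlepath 0 \<rho> pi (- pi)) (integrand t \<alpha> \<beta> l ln)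
    = P (Ln_lower (- of_real \<rho>)) - P (ln (- of_real \<rho>))"
    using contour_integral_integrand_circle[OF P H(1) decomp \<rho>(1,3)] Ln_of_neg_real[OF \<rho>(1)] by simp
  have FA: "contour_integral (linepath (of_real c - \<i> * of_real R) (of_real c + \<i> * of_real R)) (integrand t \<alpha> \<beta> l ln)
    = P (ln (of_real c + \<i> * of_real R)) - P (ln (of_real c - \<i> * of_real R))
      + C * contour_integral (linepath (of_real c - \<i> * of_real R) (of_real c + \<i> * of_real R)) f"
    by (subst right) (use c in \<open>auto simp: closed_segment_same_Re complex_nonpos_Reals_iff\<close>)
  have "cut_contour_integral c R \<rho> (integrand t \<alpha> \<beta> l) =
     C * (contour_integral (part_circlepath (of_real c) (- R) (- (pi / 2)) 0) f
   + contour_integral (part_circlepath (of_real c) (- R) 0 (pi / 2)) f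
   + contour_integral (linepath (of_real c - \<i> * of_real R) (of_real c + \<i> * of_real R)) f)"
    unfolding cut_contour_integral_def AB BC CD DE EF FA BCDE by (simp add: algebra_simps)
  also have "\<dots> = C * (2 * of_real pi * \<i>)"
    unfolding f_def by (subst winding_half_disc) (use c in auto)
  finally show ?thesis by (simp add: C_def mult_ac)
qed

section \<open>Shrinking the circle\<close>

text \<open>The substitution z = exp w turns the circle of radius r, cut at - r, into this segment.\<close>

definition vertical_integral :: "real \<Rightarrow> (complex \<Rightarrow> complex) \<Rightarrow> complex" where
  "vertical_integral r g =
     contour_integral (linepath (of_real (ln r) - \<i> * of_real pi) (of_real (ln r) + \<i> * of_real pi)) g"

text \<open>The factor 2 i makes the jump of \<^term>\<open>log_integrand t \<alpha> \<beta> l\<close> equal to the real-variable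
  density of the theorem; the factor v comes from dz = exp w dw.\<close>

definition jump :: "(complex \<Rightarrow> complex) \<Rightarrow> real \<Rightarrow> complex" where
  "jump g v = (g (of_real (ln v) + \<i> * of_real pi) - g (of_real (ln v) - \<i> * of_real pi)) / (2 * \<i> * of_real v)"

section \<open>Values of the integrand on the two sides of the cut\<close>

lemma exp_log_polar:
  assumes "0 < v"
  shows "exp (of_real a * (of_real (ln v) + \<i> * of_real \<phi>)) = of_real (v powr a) * cis (a * \<phi>)"
proof -
  have "of_real a * (of_real (ln v) + \<i> * of_real \<phi>) = of_real (a * ln v) + \<i> * of_real (a * \<phi>)"
    by (simp add: distrib_left mult_ac)
  moreover have "exp (complex_of_real (a * ln v)) = of_real (v powr a)"
    using assms unfolding exp_of_real powr_def by simp
  ultimately show ?thesis by (simp only: exp_add cis_conv_exp)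
qed

lemma cis_minus_pi: "cis (- pi) = - 1"
  by (simp add: complex_eq_iff)

lemma exp_log_side:
  assumes "0 < v" "\<phi> = pi \<or> \<phi> = - pi"
  shows "exp (of_real (ln v) + \<i> * of_real \<phi>) = - of_real v"
  using exp_log_polar[OF assms(1), of 1 \<phi>] assms by (auto simp: cis_minus_pi)

text \<open>On the sides of the cut z^alpha runs through the two rays of argument alpha pi and -
  alpha pi, which miss l by the condition on \<open>Arg l\<close>.\<close>

lemma ray_ne:
  assumes "0 < \<alpha>" "\<alpha> < 1" "\<bar>Arg l\<bar> \<noteq> \<alpha> * pi" "\<phi> = pi \<or> \<phi> = - pi" "0 < x"
  shows "of_real x * cis (\<alpha> * \<phi>) \<noteq> l"
proof
  assume "of_real x * cis (\<alpha> * \<phi>) = l"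
  moreover have abs: "\<bar>\<alpha> * \<phi>\<bar> = \<alpha> * pi" using assms by (auto simp: abs_mult)
  moreover have "\<alpha> * pi < 1 * pi" using assms by (intro mult_strict_right_mono) auto
  then have "\<bar>\<alpha> * \<phi>\<bar> < pi" using abs by simp
  then have "\<alpha> * \<phi> \<in> {- pi<..pi}" unfolding greaterThanAtMost_iff by linarith
  then have "Arg (cis (\<alpha> * \<phi>)) = \<alpha> * \<phi>" by (rule Arg_cis)
  ultimately have "Arg l = \<alpha> * \<phi>" using assms(5) by auto
  then show False using assms \<open>\<bar>\<alpha> * \<phi>\<bar> = \<alpha> * pi\<close> by simp
qed

text \<open>A lower bound for the denominator that is uniform along the whole cut, up to the origin.
  Turning a ray back onto the nonnegative reals gives a closed set, and l turned likewise lies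
  outside it, the endpoint 0 being excluded by l \<noteq> 0.\<close>

lemma ray_bound:
  assumes "0 < \<alpha>" "\<alpha> < 1" "\<bar>Arg l\<bar> \<noteq> \<alpha> * pi" "l \<noteq> 0"
  obtains \<delta> where "0 < \<delta>"
    "\<And>\<phi> x. \<phi> = pi \<or> \<phi> = - pi \<Longrightarrow> 0 \<le> x \<Longrightarrow> \<delta> \<le> cmod (of_real x * cis (\<alpha> * \<phi>) - l)"
proof -
  have ray: "\<exists>\<delta>>0. \<forall>x\<ge>0. \<delta> \<le> cmod (of_real x * cis (\<alpha> * \<phi>) - l)" if \<phi>: "\<phi> = pi \<or> \<phi> = - pi" for \<phi>
  proof -
    define u where "u = l * cis (- (\<alpha> * \<phi>))"
    have l: "l = u * cis (\<alpha> * \<phi>)" by (simp add: u_def cis_mult mult.assoc)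
    have "u \<notin> \<real>\<^sub>\<ge>\<^sub>0"
    proof
      assume "u \<in> \<real>\<^sub>\<ge>\<^sub>0"
      then obtain x where x: "u = of_real x" "0 \<le> x" by (auto simp: nonneg_Reals_def)
      then have "0 < x" using l assms(4) by (cases "x = 0") auto
      then show False using ray_ne[OF assms(1-3) \<phi> \<open>0 < x\<close>] l x by simp
    qed
    then have "0 < infdist u \<real>\<^sub>\<ge>\<^sub>0"
      using nonneg_Reals_zero_I by (intro infdist_pos_not_in_closed closed_nonneg_Reals_complex) blast+
    moreover have "infdist u \<real>\<^sub>\<ge>\<^sub>0 \<le> cmod (of_real x * cis (\<alpha> * \<phi>) - l)" if "0 \<le> x" for x
    proof -
      have "infdist u \<real>\<^sub>\<ge>\<^sub>0 \<le> dist u (of_real x)" using that by (intro infdist_le) auto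
      also have "\<dots> = cmod ((of_real x - u) * cis (\<alpha> * \<phi>))"
        by (simp add: norm_mult dist_norm norm_minus_commute)
      also have "\<dots> = cmod (of_real x * cis (\<alpha> * \<phi>) - l)" by (simp add: l left_diff_distrib)
      finally show ?thesis .
    qed
    ultimately show ?thesis by blast
  qed
  obtain d where d: "0 < d" "\<forall>x\<ge>0. d \<le> cmod (of_real x * cis (\<alpha> * pi) - l)" using ray[of pi] by blast
  obtain e where e: "0 < e" "\<forall>x\<ge>0. e \<le> cmod (of_real x * cis (\<alpha> * - pi) - l)" using ray[of "- pi"] by blast
  show ?thesis
    by (rule that[of "min d e"]) (use d e in \<open>auto simp: min_le_iff_disj\<close>)
qed

lemma log_integrand_side:
  assumes "0 < v" "\<phi> = pi \<or> \<phi> = - pi"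
  shows "log_integrand t \<alpha> \<beta> l (of_real (ln v) + \<i> * of_real \<phi>)
    = - of_real (exp (- v * t) * v powr (\<alpha> - \<beta>) * v) * cis ((\<alpha> - \<beta>) * \<phi>) / (of_real (v powr \<alpha>) * cis (\<alpha> * \<phi>) - l)"
proof -
  let ?w = "complex_of_real (ln v) + \<i> * of_real \<phi>"
  have "exp (of_real (\<alpha> - \<beta> + 1) * ?w) = of_real (v powr (\<alpha> - \<beta> + 1)) * cis ((\<alpha> - \<beta> + 1) * \<phi>)"
    by (rule exp_log_polar) fact
  moreover have "cis ((\<alpha> - \<beta> + 1) * \<phi>) = - cis ((\<alpha> - \<beta>) * \<phi>)"
    using assms(2) by (auto simp: distrib_right cis_minus_pi simp flip: cis_mult)
  moreover have "v powr (\<alpha> - \<beta> + 1) = v powr (\<alpha> - \<beta>) * v" using assms(1) by (simp add: powr_add)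
  moreover have "exp (exp ?w * of_real t) = of_real (exp (- v * t))"
    unfolding exp_log_side[OF assms] by (simp flip: exp_of_real)
  ultimately show ?thesis
    unfolding log_integrand_def exp_add exp_log_polar[OF assms(1)] by simp
qed

text \<open>The two denominators x exp (i alpha pi) - l and x exp (- i alpha pi) - l with x =
  v^alpha multiply to the quadratic of the density. For complex l they are not conjugate, so the
  jump is computed over the common denominator and not as an imaginary part.\<close>

lemma cut_density_eq_jump:
  assumes "0 < \<alpha>" "\<alpha> < 1" "\<bar>Arg l\<bar> \<noteq> \<alpha> * pi" "0 < v"
  shows "cut_density t \<alpha> \<beta> l v = jump (log_integrand t \<alpha> \<beta> l) v"
proof -
  define x where "x = complex_of_real (v powr \<alpha>)"
  define e where "e = complex_of_real (exp (- v * t) * v powr (\<alpha> - \<beta>))"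
  define a where "a = cis (\<alpha> * pi)"
  define a' where "a' = cis (\<alpha> * - pi)"
  define d where "d = cis ((\<alpha> - \<beta>) * pi)"
  define d' where "d' = cis ((\<alpha> - \<beta>) * - pi)"
  have ne: "x * a - l \<noteq> 0" "x * a' - l \<noteq> 0"
    using ray_ne[OF assms(1-3), of pi "v powr \<alpha>"] ray_ne[OF assms(1-3), of "- pi" "v powr \<alpha>"] assms(4)
    by (auto simp: x_def a_def a'_def)
  have v: "complex_of_real v \<noteq> 0" using assms(4) by simp
  have cancel: "e * (k * N) / (k * D) = e * (N / D)" if "k \<noteq> 0" for k N D :: complex
    using that by simp
  have "jump (log_integrand t \<alpha> \<beta> l) v = (- (e * of_real v) * d / (x * a - l) - - (e * of_real v) * d' / (x * a' - l)) / (2 * \<i> * of_real v)"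
    using log_integrand_side[OF assms(4), of pi] log_integrand_side[OF assms(4), of "- pi"]
    by (simp add: jump_def x_def a_def a'_def d_def d'_def e_def)
  also have "\<dots> = (e * (x * (d' * a - d * a') - l * (d' - d))) / (2 * \<i> * ((x * a - l) * (x * a' - l)))"
    using ne v by (simp add: divide_simps) (simp add: algebra_simps)
  also have "d' * a - d * a' = 2 * \<i> * of_real (sin (\<beta> * pi))"
    unfolding d_def d'_def a_def a'_def cis_mult
    by (simp add: complex_eq_iff algebra_simps)
  also have "d' - d = - (2 * \<i> * of_real (sin ((\<alpha> - \<beta>) * pi)))"
    unfolding d_def d'_def by (simp add: complex_eq_iff)
  also have "(x * a - l) * (x * a' - l) = x\<^sup>2 * (a * a') - l * x * (a + a') + l\<^sup>2"
    by (simp add: algebra_simps power2_eq_square)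
  also have "a * a' = 1" by (simp add: a_def a'_def cis_mult)
  also have "a + a' = 2 * of_real (cos (\<alpha> * pi))"
    unfolding a_def a'_def by (simp add: complex_eq_iff)
  also have "x\<^sup>2 = of_real (v powr (2 * \<alpha>))"
    using powr_add[of v \<alpha> \<alpha>] by (simp add: x_def power2_eq_square)
  also have "e * (x * (2 * \<i> * of_real (sin (\<beta> * pi))) - l * - (2 * \<i> * of_real (sin ((\<alpha> - \<beta>) * pi)))) /
     (2 * \<i> * (of_real (v powr (2 * \<alpha>)) * 1 - l * x * (2 * of_real (cos (\<alpha> * pi))) + l\<^sup>2)) =
     e * (2 * \<i> * (x * of_real (sin (\<beta> * pi)) + l * of_real (sin ((\<alpha> - \<beta>) * pi)))) /
     (2 * \<i> * (of_real (v powr (2 * \<alpha>)) * 1 - l * x * (2 * of_real (cos (\<alpha> * pi))) + l\<^sup>2))"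
    by (simp add: algebra_simps)
  also have "\<dots> = e * ((x * of_real (sin (\<beta> * pi)) + l * of_real (sin ((\<alpha> - \<beta>) * pi))) /
     (of_real (v powr (2 * \<alpha>)) * 1 - l * x * (2 * of_real (cos (\<alpha> * pi))) + l\<^sup>2))"
    by (rule cancel) simp
  also have "\<dots> = cut_density t \<alpha> \<beta> l v"
    by (simp add: cut_density_def e_def x_def mult_ac)
  finally show ?thesis ..
qed

section \<open>Cauchy's theorem on a rectangle in the logarithmic coordinate\<close>

lemma norm_exp_log:
  assumes "Re w = ln r" "0 < r" "0 \<le> t"
  shows "cmod (exp (exp w * of_real t + of_real a * w)) \<le> exp (r * t) * r powr a"
proof -
  have "cmod (exp w) = r" using assms by (simp add: norm_exp_eq_Re)
  then have "Re (exp w) \<le> r" using complex_Re_le_cmod[of "exp w"] by simp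
  then have "Re (exp w * of_real t + of_real a * w) \<le> r * t + a * ln r"
    using assms by (simp add: mult_right_mono)
  then have "cmod (exp (exp w * of_real t + of_real a * w)) \<le> exp (r * t + a * ln r)"
    unfolding norm_exp_eq_Re by (subst exp_le_cancel_iff)
  also have "\<dots> = exp (r * t) * r powr a" using assms(2) by (simp add: exp_add powr_def)
  finally show ?thesis .
qed

lemma contour_integral_linepath_horizontal:
  assumes "x1 < x2"
  shows "contour_integral (linepath (of_real x1 + c) (of_real x2 + c)) g
    = integral {x1..x2} (\<lambda>x. g (of_real x + c))"
proof -
  have "contour_integral (linepath (of_real x1 + c) (of_real x2 + c)) g
     = contour_integral (linepath (of_real x1) (of_real x2)) (\<lambda>z. g (z + c))"
    by (simp add: contour_integral_integral linepath_def algebra_simps)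
  then show ?thesis using assms
    by (simp add: contour_integral_linepath_Reals_eq)
qed

text \<open>The horizontal edges at heights pi and - pi are the two sides of the cut; the
  substitution x = ln v joins them into one integral over v, whose factor 1 / v is part of
  \<open>jump\<close>.\<close>

lemma jump_integral:
  assumes "0 < \<rho>" "\<rho> < r"
    and "continuous_on {w. \<bar>Im w\<bar> = pi} g"
  shows "contour_integral (linepath (of_real (ln \<rho>) + \<i> * of_real pi) (of_real (ln r) + \<i> * of_real pi)) g
      - contour_integral (linepath (of_real (ln \<rho>) - \<i> * of_real pi) (of_real (ln r) - \<i> * of_real pi)) g
     = 2 * \<i> * (LINT v:{\<rho>..r}|lborel. jump g v)"
proof -
  have cont: "continuous_on A (\<lambda>x. g (of_real x + \<i> * of_real pi))"
      "continuous_on A (\<lambda>x. g (of_real x - \<i> * of_real pi))" for A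
    by (intro continuous_on_compose2[OF assms(3)] continuous_intros; force)+
  have ln: "ln \<rho> < ln r" using assms by simp
  let ?f = "\<lambda>x. g (of_real x + \<i> * of_real pi) - g (of_real x - \<i> * of_real pi)"
  have "continuous_on {\<rho>..r} (\<lambda>v. ?f (ln v) / (2 * \<i> * of_real v))"
    using assms(1)
    by (intro continuous_intros continuous_on_compose2[OF cont(1)] continuous_on_compose2[OF cont(2)]) auto
  then have int: "set_integrable lborel {\<rho>..r} (jump g)"
    unfolding jump_def[abs_def] by (rule borel_integrable_atLeastAtMost')
  have "((\<lambda>v. (1 / v) *\<^sub>R ?f (ln v)) has_integral (integral {ln \<rho>..ln r} ?f)) {\<rho>..r}"
  proof (rule has_integral_substitution)
    show "ln ` {\<rho>..r} \<subseteq> {ln \<rho>..ln r}" using assms by auto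
    show "continuous_on {ln \<rho>..ln r} ?f" by (intro continuous_intros cont)
  qed (use assms in \<open>auto intro!: derivative_eq_intros\<close>)
  then have "((\<lambda>v. 2 * \<i> * jump g v) has_integral (integral {ln \<rho>..ln r} ?f)) {\<rho>..r}"
    by (rule has_integral_eq[rotated]) (use assms in \<open>auto simp: jump_def scaleR_conv_of_real field_simps\<close>)
  then have "integral {ln \<rho>..ln r} ?f = integral {\<rho>..r} (\<lambda>v. 2 * \<i> * jump g v)"
    by (rule integral_unique[symmetric])
  also have "\<dots> = 2 * \<i> * integral {\<rho>..r} (jump g)" by simp
  also have "integral {\<rho>..r} (jump g) = (LINT v:{\<rho>..r}|lborel. jump g v)"
    using set_borel_integral_eq_integral(2)[OF int] by simp
  also have "integral {ln \<rho>..ln r} ?f = integral {ln \<rho>..ln r} (\<lambda>x. g (of_real x + \<i> * of_real pi))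
      - integral {ln \<rho>..ln r} (\<lambda>x. g (of_real x - \<i> * of_real pi))"
    by (intro Henstock_Kurzweil_Integration.integral_diff integrable_continuous_interval cont)
  finally show "contour_integral (linepath (of_real (ln \<rho>) + \<i> * of_real pi) (of_real (ln r) + \<i> * of_real pi)) g
      - contour_integral (linepath (of_real (ln \<rho>) - \<i> * of_real pi) (of_real (ln r) - \<i> * of_real pi)) g
     = 2 * \<i> * (LINT v:{\<rho>..r}|lborel. jump g v)"
    using contour_integral_linepath_horizontal[OF ln, of "\<i> * of_real pi" g]
      contour_integral_linepath_horizontal[OF ln, of "- (\<i> * of_real pi)" g] by simp
qed

text \<open>In w the annulus between the radii rho and r, cut along the negative axis, is a
  rectangle that winds once around Ln z0. Its vertical edges are the two circles and its horizontal
  edges are the sides of the cut.\<close>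

lemma vertical_integral_diff:
  fixes t \<alpha> \<beta> :: real
  assumes "0 < \<alpha>" "\<alpha> < 1" "\<bar>Arg l\<bar> \<noteq> \<alpha> * pi"
    and z0: "z0 \<notin> \<real>\<^sub>\<le>\<^sub>0" "\<And>z. is_branch_root \<alpha> l z \<Longrightarrow> z = z0"
    and \<rho>: "0 < \<rho>" "\<rho> < cmod z0" "cmod z0 < r"
  defines "G \<equiv> log_integrand t \<alpha> \<beta> l"
  shows "vertical_integral r G
    = vertical_integral \<rho> G + 2 * \<i> * (LINT v:{\<rho>..r}|lborel. jump G v) + 2 * of_real pi * \<i> * branch_residue t \<alpha> \<beta> l"
proof -
  obtain \<eta> H where H: "\<eta> > pi" "H holomorphic_on {w. \<bar>Im w\<bar> < \<eta>}"
    and nz: "\<And>w. \<bar>Im w\<bar> < \<eta> \<Longrightarrow> w \<noteq> Ln z0 \<Longrightarrow> exp (of_real \<alpha> * w) \<noteq> l"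
    and decomp: "\<And>w. \<bar>Im w\<bar> < \<eta> \<Longrightarrow> w \<noteq> Ln z0 \<Longrightarrow>
       log_integrand t \<alpha> \<beta> l w = branch_residue t \<alpha> \<beta> l / (w - Ln z0) + H w"
    using log_integrand_pole[OF assms(1-3) z0, of t \<beta>] by blast
  define C where "C = branch_residue t \<alpha> \<beta> l"
  define w0 where "w0 = Ln z0"
  have nz0: "z0 \<noteq> 0" using z0(1) by auto
  have w0: "Re w0 = ln (cmod z0)" "\<bar>Im w0\<bar> < pi"
    using abs_Im_Ln_less_pi[OF z0(1)] nz0 by (auto simp: w0_def)
  have Re_w0: "ln \<rho> < Re w0" "Re w0 < ln r" using w0 \<rho> nz0 by auto
  have contG: "continuous_on ({w. \<bar>Im w\<bar> < \<eta>} - {w0}) G"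
    unfolding G_def log_integrand_def
    using nz by (intro continuous_intros) (auto simp: w0_def)
  define a1 where "a1 = of_real (ln \<rho>) - \<i> * of_real pi"
  define a2 where "a2 = of_real (ln r) - \<i> * of_real pi"
  define a3 where "a3 = of_real (ln r) + \<i> * of_real pi"
  define a4 where "a4 = of_real (ln \<rho>) + \<i> * of_real pi"
  have rect: "rectpath a1 a3 = linepath a1 a2 +++ linepath a2 a3 +++ linepath a3 a4 +++ linepath a4 a1"
    by (simp add: rectpath_def Let_def a1_def a2_def a3_def a4_def Complex_eq)
  have box: "w0 \<in> box a1 a3" using Re_w0 w0(2)
    by (auto simp: in_box_complex_iff a1_def a3_def)
  have img: "path_image (rectpath a1 a3) \<subseteq> {w. \<bar>Im w\<bar> < \<eta>} - {w0}"
  proof -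
    have "path_image (rectpath a1 a3) \<subseteq> cbox a1 a3"
      by (rule path_image_rectpath_subset_cbox) (use Re_w0 in \<open>auto simp: a1_def a3_def\<close>)
    moreover have "cbox a1 a3 \<subseteq> {w. \<bar>Im w\<bar> < \<eta>}"
      using H(1) by (auto simp: in_cbox_complex_iff a1_def a3_def)
    moreover have "w0 \<notin> path_image (rectpath a1 a3)"
      using path_image_rectpath_inter_box[of a1 a3] box Re_w0 by (auto simp: a1_def a3_def)
    ultimately show ?thesis by blast
  qed
  have "((\<lambda>w. 1 / (w - w0)) has_contour_integral 2 * of_real pi * \<i> * winding_number (rectpath a1 a3) w0) (rectpath a1 a3)"
    using has_contour_integral_winding_number[of "rectpath a1 a3" w0] img by auto
  then have "((\<lambda>w. C * (1 / (w - w0))) has_contour_integral C * (2 * of_real pi * \<i>)) (rectpath a1 a3)"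
    using winding_number_rectpath[OF box] by (intro has_contour_integral_lmul) simp
  moreover have "(H has_contour_integral 0) (rectpath a1 a3)"
    by (rule Cauchy_theorem_convex_simple[OF H(2) convex_strip]) (use img in auto)
  ultimately have "((\<lambda>w. C * (1 / (w - w0)) + H w) has_contour_integral C * (2 * of_real pi * \<i>) + 0) (rectpath a1 a3)"
    by (rule has_contour_integral_add)
  then have G: "(G has_contour_integral C * (2 * of_real pi * \<i>) + 0) (rectpath a1 a3)"
  proof (rule has_contour_integral_eq)
    fix w assume "w \<in> path_image (rectpath a1 a3)"
    then have "\<bar>Im w\<bar> < \<eta>" "w \<noteq> Ln z0" using img by (auto simp: w0_def)
    then show "C * (1 / (w - w0)) + H w = G w"
      using decomp[of w] by (simp add: G_def C_def w0_def)
  qed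
  have segs: "closed_segment a1 a2 \<subseteq> path_image (rectpath a1 a3)" "closed_segment a2 a3 \<subseteq> path_image (rectpath a1 a3)"
    "closed_segment a3 a4 \<subseteq> path_image (rectpath a1 a3)" "closed_segment a4 a1 \<subseteq> path_image (rectpath a1 a3)"
    unfolding rect by (auto simp: path_image_join)
  have int: "G contour_integrable_on linepath a1 a2" "G contour_integrable_on linepath a2 a3"
    "G contour_integrable_on linepath a3 a4" "G contour_integrable_on linepath a4 a1"
    by (rule contour_integrable_continuous_linepath, rule continuous_on_subset[OF contG], use segs img in blast)+
  have "C * (2 * of_real pi * \<i>) = contour_integral (linepath a1 a2) G + (contour_integral (linepath a2 a3) G
     + (contour_integral (linepath a3 a4) G + contour_integral (linepath a4 a1) G))"
    using contour_integral_unique[OF G] int unfolding rect by simp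
  moreover have "contour_integral (linepath a3 a4) G = - contour_integral (linepath a4 a3) G"
    "contour_integral (linepath a4 a1) G = - contour_integral (linepath a1 a4) G"
    by (rule contour_integral_reverse_linepath, rule continuous_on_subset[OF contG], use segs img in blast)+
  moreover have cs: "continuous_on {w. \<bar>Im w\<bar> = pi} G"
    by (rule continuous_on_subset[OF contG]) (use H(1) w0 in auto)
  have "contour_integral (linepath a4 a3) G - contour_integral (linepath a1 a2) G = 2 * \<i> * (LINT v:{\<rho>..r}|lborel. jump G v)"
    unfolding a1_def a2_def a3_def a4_def by (rule jump_integral[OF _ _ cs]) (use \<rho> in auto)
  ultimately show "vertical_integral r G
    = vertical_integral \<rho> G + 2 * \<i> * (LINT v:{\<rho>..r}|lborel. jump G v) + 2 * of_real pi * \<i> * branch_residue t \<alpha> \<beta> l"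
    by (simp add: vertical_integral_def a1_def a2_def a3_def a4_def C_def algebra_simps)
qed

section \<open>Integrability along the cut and the limit of vanishing radius\<close>

lemma integrable_exp_powr:
  fixes t s :: real
  assumes "0 < t" "-1 < s"
  shows "set_integrable lborel {0<..} (\<lambda>v. exp (- v * t) * v powr s)"
proof -
  have "(\<lambda>v. complex_of_real v powr (of_real (s + 1) - 1) / of_real (exp (t * v))) absolutely_integrable_on {0<..}"
    using absolutely_integrable_Gamma_integral[of "of_real (s + 1)" t] assms by simp
  then have "integrable lborel (\<lambda>v. indicator {0<..} v *\<^sub>R (complex_of_real v powr (of_real (s + 1) - 1) / of_real (exp (t * v))))"
    unfolding set_integrable_def by (subst (asm) integrable_completion) auto
  from integrable_norm[OF this] show ?thesis
    unfolding set_integrable_def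
    by (rule Bochner_Integration.integrable_cong[THEN iffD1, OF refl, rotated])
      (auto simp: indicator_def norm_divide norm_powr_real_powr exp_minus field_simps)
qed

lemma integral_exp_powr:
  fixes t s :: real
  assumes "0 < t" "-1 < s"
  shows "(LINT v:{0<..}|lborel. exp (- v * t) * v powr s) = Gamma (s + 1) / t powr (s + 1)"
proof -
  have 1: "set_integrable lborel {0<..} (\<lambda>v. exp (- v * 1) * v powr s)"
    using assms by (intro integrable_exp_powr) auto
  have "((\<lambda>v. exp (- v * 1) * v powr s) has_integral Gamma (s + 1)) {0..}"
    using Gamma_integral_real[of "s + 1"] assms(2) by (simp add: exp_minus field_simps)
  then have "((\<lambda>v. exp (- v * 1) * v powr s) has_integral Gamma (s + 1)) {0<..}"
    by (subst has_integral_spike_set_eq[of _ "{0..}"]) (auto intro: negligible_subset[of "{0}"])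
  then have "Gamma (s + 1) = (LINT v:{0<..}|lborel. exp (- v * 1) * v powr s)"
    using set_borel_integral_eq_integral(2)[OF 1] by (simp add: integral_unique)
  also have "\<dots> = t * (\<integral>v. indicator {0<..} (0 + t * v) *\<^sub>R (exp (- (0 + t * v) * 1) * (0 + t * v) powr s) \<partial>lborel)"
    unfolding set_lebesgue_integral_def
    using assms(1) by (subst lborel_integral_real_affine[of t _ 0]) auto
  also have "(\<integral>v. indicator {0<..} (0 + t * v) *\<^sub>R (exp (- (0 + t * v) * 1) * (0 + t * v) powr s) \<partial>lborel)
     = (\<integral>v. t powr s * (indicator {0<..} v *\<^sub>R (exp (- v * t) * v powr s)) \<partial>lborel)"
    using assms(1) by (intro Bochner_Integration.integral_cong) (auto simp: indicator_def powr_mult zero_less_mult_iff mult_ac)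
  also have "\<dots> = t powr s * (LINT v:{0<..}|lborel. exp (- v * t) * v powr s)"
    unfolding set_lebesgue_integral_def by simp
  finally show ?thesis using assms(1) by (simp add: powr_add field_simps)
qed

lemma set_borel_measurable_jump:
  assumes "continuous_on {w. \<bar>Im w\<bar> = pi} g"
  shows "set_borel_measurable lborel {0<..} (jump g)"
proof -
  have cont: "continuous_on A (\<lambda>x. g (of_real x + \<i> * of_real pi))"
      "continuous_on A (\<lambda>x. g (of_real x - \<i> * of_real pi))" for A
    by (intro continuous_on_compose2[OF assms] continuous_intros; force)+
  have "continuous_on {0<..} (jump g)"
    unfolding jump_def[abs_def]
    by (intro continuous_intros continuous_on_compose2[OF cont(1)] continuous_on_compose2[OF cont(2)]) auto
  then show ?thesis
    using borel_measurable_continuous_on_indicator[of "{0<..}" "jump g"]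
    by (simp add: set_borel_measurable_def)
qed

lemma continuous_log_integrand_sides:
  assumes "0 < \<alpha>" "\<alpha> < 1" "\<bar>Arg l\<bar> \<noteq> \<alpha> * pi"
  shows "continuous_on {w. \<bar>Im w\<bar> = pi} (log_integrand t \<alpha> \<beta> l)"
proof -
  obtain \<eta> where "\<eta> > pi" "\<And>w. \<bar>Im w\<bar> < \<eta> \<Longrightarrow> exp (of_real \<alpha> * w) = l \<Longrightarrow> \<bar>Im w\<bar> < pi"
    using exp_eq_on_strip[OF assms] by blast
  then have "exp (of_real \<alpha> * w) \<noteq> l" if "\<bar>Im w\<bar> = pi" for w
    using that by (metis less_irrefl)
  then show ?thesis
    unfolding log_integrand_def by (intro continuous_intros) auto
qed

lemma norm_jump_le:
  assumes "0 < v"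
    "cmod (g (of_real (ln v) + \<i> * of_real pi)) \<le> B * v" "cmod (g (of_real (ln v) - \<i> * of_real pi)) \<le> B * v"
  shows "cmod (jump g v) \<le> B"
proof -
  have "cmod (g (of_real (ln v) + \<i> * of_real pi) - g (of_real (ln v) - \<i> * of_real pi)) \<le> B * v + B * v"
    using norm_triangle_ineq4 assms(2,3) by (rule order_trans[OF _ add_mono])
  then show ?thesis using assms(1) by (simp add: jump_def norm_divide norm_mult field_simps)
qed

text \<open>Only v near 0 is critical. For l \<noteq> 0 the denominator stays away from 0, and
  v^(alpha - beta) is integrable there as beta < alpha + 1. For l = 0 the denominator has modulus
  v^alpha, which leaves v^(- beta) and requires beta < 1.\<close>

lemma set_integrable_jump:
  assumes "0 < t" "0 < \<alpha>" "\<alpha> < 1" "\<bar>Arg l\<bar> \<noteq> \<alpha> * pi" "\<beta> < \<alpha> + 1" "l \<noteq> 0 \<or> \<beta> < 1"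
  shows "set_integrable lborel {0<..} (jump (log_integrand t \<alpha> \<beta> l))"
proof -
  obtain K s where s: "-1 < s" and "0 \<le> K" and
    le: "\<And>v \<phi>. 0 < v \<Longrightarrow> \<phi> = pi \<or> \<phi> = - pi \<Longrightarrow>
        cmod (log_integrand t \<alpha> \<beta> l (of_real (ln v) + \<i> * of_real \<phi>)) \<le> K * (exp (- v * t) * v powr s) * v"
  proof (cases "l = 0")
    case True
    show ?thesis
    proof (rule that[of "- \<beta>" 1])
      fix v \<phi> :: real assume "0 < v" "\<phi> = pi \<or> \<phi> = - pi"
      then show "cmod (log_integrand t \<alpha> \<beta> l (of_real (ln v) + \<i> * of_real \<phi>)) \<le> 1 * (exp (- v * t) * v powr - \<beta>) * v"
        unfolding log_integrand_side[OF \<open>0 < v\<close> \<open>\<phi> = pi \<or> \<phi> = - pi\<close>] using True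
        by (simp add: norm_mult norm_divide powr_diff powr_minus field_simps)
    qed (use True assms in auto)
  next
    case False
    then obtain \<delta> where \<delta>: "0 < \<delta>"
      "\<And>\<phi> x. \<phi> = pi \<or> \<phi> = - pi \<Longrightarrow> 0 \<le> x \<Longrightarrow> \<delta> \<le> cmod (of_real x * cis (\<alpha> * \<phi>) - l)"
      using ray_bound[OF assms(2-4)] by blast
    show ?thesis
    proof (rule that[of "\<alpha> - \<beta>" "1 / \<delta>"])
      fix v \<phi> :: real assume v: "0 < v" "\<phi> = pi \<or> \<phi> = - pi"
      have "cmod (log_integrand t \<alpha> \<beta> l (of_real (ln v) + \<i> * of_real \<phi>))
        = exp (- v * t) * v powr (\<alpha> - \<beta>) * v / cmod (of_real (v powr \<alpha>) * cis (\<alpha> * \<phi>) - l)"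
        unfolding log_integrand_side[OF v] using v by (simp add: norm_mult norm_divide)
      also have "\<dots> \<le> exp (- v * t) * v powr (\<alpha> - \<beta>) * v / \<delta>"
        using \<delta>(1) \<delta>(2)[OF v(2), of "v powr \<alpha>"] v by (intro divide_left_mono mult_pos_pos) auto
      finally show "cmod (log_integrand t \<alpha> \<beta> l (of_real (ln v) + \<i> * of_real \<phi>)) \<le> 1 / \<delta> * (exp (- v * t) * v powr (\<alpha> - \<beta>)) * v"
        by simp
    qed (use assms \<delta> in auto)
  qed
  have "set_integrable lborel {0<..} (\<lambda>v. K * (exp (- v * t) * v powr s))"
    using integrable_exp_powr[OF assms(1) s] by (rule set_integrable_mult_right)
  then show ?thesis
  proof (rule set_integrable_bound)
    show "set_borel_measurable lborel {0<..} (jump (log_integrand t \<alpha> \<beta> l))"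
      by (intro set_borel_measurable_jump continuous_log_integrand_sides assms)
    have "cmod (jump (log_integrand t \<alpha> \<beta> l) v) \<le> norm (K * (exp (- v * t) * v powr s))" if "0 < v" for v
      using norm_jump_le[OF that, of "log_integrand t \<alpha> \<beta> l" "K * (exp (- v * t) * v powr s)"] le[OF that, of pi] le[OF that, of "- pi"] \<open>0 \<le> K\<close>
      by simp
    then show "AE v in lborel. v \<in> {0<..} \<longrightarrow> cmod (jump (log_integrand t \<alpha> \<beta> l) v) \<le> norm (K * (exp (- v * t) * v powr s))"
      by simp
  qed
qed

lemma vertical_integral_bound:
  assumes "0 \<le> B" "continuous_on {w. Re w = ln r \<and> \<bar>Im w\<bar> \<le> pi} g"
    and "\<And>w. Re w = ln r \<Longrightarrow> \<bar>Im w\<bar> \<le> pi \<Longrightarrow> cmod (g w) \<le> B"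
  shows "cmod (vertical_integral r g) \<le> B * (2 * pi)"
proof -
  have seg: "closed_segment (of_real (ln r) - \<i> * of_real pi) (of_real (ln r) + \<i> * of_real pi)
      \<subseteq> {w. Re w = ln r \<and> \<bar>Im w\<bar> \<le> pi}"
    by (subst closed_segment_same_Re) (auto simp: closed_segment_eq_real_ivl split: if_splits)
  have "cmod (vertical_integral r g) \<le> B * cmod (of_real (ln r) + \<i> * of_real pi - (of_real (ln r) - \<i> * of_real pi))"
    unfolding vertical_integral_def
    by (intro contour_integral_bound_linepath contour_integrable_continuous_linepath
        continuous_on_subset[OF assms(2) seg] assms(1)) (use seg assms(3) in auto)
  then show ?thesis by (simp add: norm_mult)
qed

text \<open>On the circle of radius rho the integrand times dz/dw is O(rho^s) with s > 0: s = 1 -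
  beta for l = 0, and s = alpha - beta + 1 otherwise, since |z^alpha - l| \<ge> |l| / 2 once
  rho^alpha < |l| / 2. The length 2 pi of the segment does not depend on rho.\<close>

lemma vertical_integral_tendsto_0:
  assumes "0 < t" "0 < \<alpha>" "\<beta> < \<alpha> + 1" "l \<noteq> 0 \<or> \<beta> < 1"
  shows "((\<lambda>\<rho>. vertical_integral \<rho> (log_integrand t \<alpha> \<beta> l)) \<longlongrightarrow> 0) (at_right 0)"
proof -
  obtain K s where s: "0 < s" and "0 \<le> K" and
    le: "\<forall>\<^sub>F \<rho> in at_right 0. \<forall>w. Re w = ln \<rho> \<longrightarrow> exp (of_real \<alpha> * w) \<noteq> l \<and>
        cmod (log_integrand t \<alpha> \<beta> l w) \<le> K * (exp (\<rho> * t) * \<rho> powr s)"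
  proof (cases "l = 0")
    case True
    show ?thesis
    proof (rule that[of "1 - \<beta>" 1])
      show "\<forall>\<^sub>F \<rho> in at_right 0. \<forall>w. Re w = ln \<rho> \<longrightarrow> exp (of_real \<alpha> * w) \<noteq> l \<and>
        cmod (log_integrand t \<alpha> \<beta> l w) \<le> 1 * (exp (\<rho> * t) * \<rho> powr (1 - \<beta>))"
        using eventually_at_right_less
      proof eventually_elim
        case (elim \<rho>)
        have "log_integrand t \<alpha> \<beta> l w = exp (exp w * of_real t + of_real (1 - \<beta>) * w)" for w
          using True by (simp add: log_integrand_def algebra_simps flip: exp_diff)
        then show ?case using norm_exp_log[of _ \<rho> t "1 - \<beta>"] elim assms True by simp
      qed
    qed (use True assms in auto)
  next
    case False
    show ?thesis
    proof (rule that[of "\<alpha> - \<beta> + 1" "1 / (cmod l / 2)"])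
      have "((\<lambda>\<rho>::real. \<rho> powr \<alpha>) \<longlongrightarrow> 0) (at_right 0)"
        by (rule tendsto_zero_powrI[OF tendsto_ident_at tendsto_const])
          (use assms in \<open>auto simp: eventually_at_filter\<close>)
      then have "\<forall>\<^sub>F \<rho> in at_right 0. \<rho> powr \<alpha> < cmod l / 2"
        using False by (intro order_tendstoD(2)) auto
      then show "\<forall>\<^sub>F \<rho> in at_right 0. \<forall>w. Re w = ln \<rho> \<longrightarrow> exp (of_real \<alpha> * w) \<noteq> l \<and>
        cmod (log_integrand t \<alpha> \<beta> l w) \<le> 1 / (cmod l / 2) * (exp (\<rho> * t) * \<rho> powr (\<alpha> - \<beta> + 1))"
        using eventually_at_right_less
      proof eventually_elim
        case (elim \<rho>)
        show ?case
        proof (intro allI impI)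
          fix w :: complex assume w: "Re w = ln \<rho>"
          have "cmod (exp (of_real \<alpha> * w)) = \<rho> powr \<alpha>"
            using w elim by (simp add: norm_exp_eq_Re powr_def)
          then have d: "cmod l / 2 \<le> cmod (exp (of_real \<alpha> * w) - l)"
            using norm_triangle_ineq2[of l "exp (of_real \<alpha> * w)"] elim by (simp add: norm_minus_commute)
          have "cmod (log_integrand t \<alpha> \<beta> l w) \<le> exp (\<rho> * t) * \<rho> powr (\<alpha> - \<beta> + 1) / (cmod l / 2)"
            unfolding log_integrand_def norm_divide
            by (intro frac_le norm_exp_log d) (use w elim assms False in auto)
          moreover have "exp (of_real \<alpha> * w) \<noteq> l" using d False by auto
          ultimately show "exp (of_real \<alpha> * w) \<noteq> l \<and>
            cmod (log_integrand t \<alpha> \<beta> l w) \<le> 1 / (cmod l / 2) * (exp (\<rho> * t) * \<rho> powr (\<alpha> - \<beta> + 1))" by (simp add: mult_ac)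
        qed
      qed
    qed (use assms in auto)
  qed
  have bound: "\<forall>\<^sub>F \<rho> in at_right 0. norm (vertical_integral \<rho> (log_integrand t \<alpha> \<beta> l)) \<le> K * (exp (\<rho> * t) * \<rho> powr s) * (2 * pi)"
    using le
  proof eventually_elim
    case (elim \<rho>)
    show ?case
    proof (rule vertical_integral_bound)
      show "continuous_on {w. Re w = ln \<rho> \<and> \<bar>Im w\<bar> \<le> pi} (log_integrand t \<alpha> \<beta> l)"
        unfolding log_integrand_def using elim by (intro continuous_intros) auto
    qed (use elim \<open>0 \<le> K\<close> in auto)
  qed
  have "((\<lambda>\<rho>::real. \<rho> powr s) \<longlongrightarrow> 0) (at_right 0)"
    by (rule tendsto_zero_powrI[OF tendsto_ident_at tendsto_const])
      (use s in \<open>auto simp: eventually_at_filter\<close>)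
  then have "((\<lambda>\<rho>. K * (exp (\<rho> * t) * \<rho> powr s) * (2 * pi)) \<longlongrightarrow> K * (exp (0 * t) * 0) * (2 * pi)) (at_right 0)"
    by (intro tendsto_mult tendsto_exp tendsto_const tendsto_ident_at)
  then have "((\<lambda>\<rho>. K * (exp (\<rho> * t) * \<rho> powr s) * (2 * pi)) \<longlongrightarrow> 0) (at_right 0)" by simp
  with bound show ?thesis by (rule Lim_null_comparison)
qed

text \<open>The left side is the integral over Hankel's contour of radius r; rho tends to 0 in
  \<open>vertical_integral_diff\<close>, and the tail of the cut beyond r is added to both sides. It
  serves twice: with l = 0 for Hankel's formula and with the given l for the theorem.\<close>

lemma vertical_integral_shrink:
  assumes "0 < t" "0 < \<alpha>" "\<alpha> < 1" "\<bar>Arg l\<bar> \<noteq> \<alpha> * pi" "\<beta> < \<alpha> + 1" "l \<noteq> 0 \<or> \<beta> < 1"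
    and r: "0 < r" "\<And>z. is_branch_root \<alpha> l z \<Longrightarrow> cmod z < r"
  defines "G \<equiv> log_integrand t \<alpha> \<beta> l"
  shows "vertical_integral r G + 2 * \<i> * (LINT v:{r..}|lborel. jump G v)
     = 2 * of_real pi * \<i> * branch_residue t \<alpha> \<beta> l + 2 * \<i> * (LINT v:{0<..}|lborel. jump G v)"
proof -
  obtain z0 where z0: "z0 \<notin> \<real>\<^sub>\<le>\<^sub>0" "\<And>z. is_branch_root \<alpha> l z \<Longrightarrow> z = z0" "cmod z0 < r"
  proof (rule obtain_branch_root[OF assms(2,3), of "of_real (r / 2)" "\<lambda>z. cmod z < r" l])
    show "of_real (r / 2) \<notin> (\<real>\<^sub>\<le>\<^sub>0 :: complex set)" "cmod (of_real (r / 2)) < r"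
      using r(1) by (auto simp: complex_nonpos_Reals_iff)
  qed (use r(2) in auto)
  have int: "set_integrable lborel {0<..} (jump G)"
    unfolding G_def by (rule set_integrable_jump) fact+
  have "z0 \<noteq> 0" using z0(1) by auto
  then have "\<forall>\<^sub>F \<rho> in at_right 0. \<rho> < cmod z0"
    by (simp add: eventually_at_right_field) (use zero_less_norm_iff in blast)
  then have ev: "\<forall>\<^sub>F \<rho> in at_right 0. vertical_integral r G - vertical_integral \<rho> G =
      2 * \<i> * (LINT v:{\<rho>..r}|lborel. jump G v) + 2 * of_real pi * \<i> * branch_residue t \<alpha> \<beta> l"
    using eventually_at_right_less
  proof eventually_elim
    case (elim \<rho>)
    show ?case
      using vertical_integral_diff[OF assms(2-4) z0(1,2) elim(2,1) z0(3), of t \<beta>]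
      unfolding G_def by simp
  qed
  have l1: "((\<lambda>\<rho>. vertical_integral r G - vertical_integral \<rho> G) \<longlongrightarrow> vertical_integral r G - 0) (at_right 0)"
    unfolding G_def by (intro tendsto_intros vertical_integral_tendsto_0 assms)
  have int1: "set_integrable lborel {0<..r} (jump G)" "set_integrable lborel {r..} (jump G)"
    by (rule set_integrable_subset[OF int]; use r(1) in auto)+
  have l2: "((\<lambda>\<rho>. 2 * \<i> * (LINT v:{\<rho>..r}|lborel. jump G v) + 2 * of_real pi * \<i> * branch_residue t \<alpha> \<beta> l)
      \<longlongrightarrow> 2 * \<i> * (LINT v:{0<..r}|lborel. jump G v) + 2 * of_real pi * \<i> * branch_residue t \<alpha> \<beta> l) (at_right 0)"
    by (intro tendsto_intros tendsto_set_lebesgue_integral_at_right r(1) int1) auto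
  have "vertical_integral r G - 0 = 2 * \<i> * (LINT v:{0<..r}|lborel. jump G v) + 2 * of_real pi * \<i> * branch_residue t \<alpha> \<beta> l"
    by (rule tendsto_unique[OF _ Lim_transform_eventually[OF l1 ev] l2]) simp
  moreover have "(LINT v:{0<..r} \<union> {r..}|lborel. jump G v) = (LINT v:{0<..r}|lborel. jump G v) + (LINT v:{r..}|lborel. jump G v)"
    by (rule set_integral_Un_AE[OF _ _ _ int1]) (use AE_lborel_singleton[of r] in \<open>auto elim!: eventually_mono\<close>)
  moreover have "{0<..r} \<union> {r..} = {0<..}" using r(1) by auto
  ultimately show ?thesis by (simp add: algebra_simps)
qed

section \<open>Hankel's formula and the Mittag-Leffler series\<close>

text \<open>exp (t z) z^(- s) times dz/dw, at z = exp w.\<close>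

definition hankel_kernel :: "real \<Rightarrow> real \<Rightarrow> complex \<Rightarrow> complex" where
  "hankel_kernel t s w = exp (exp w * of_real t + of_real (1 - s) * w)"

text \<open>Hankel's contour integral of exp (t z) z^(-s) around the cut, which represents 1 / Gamma s.\<close>

definition hankel_integral :: "real \<Rightarrow> real \<Rightarrow> real \<Rightarrow> complex" where
  "hankel_integral t r s =
     vertical_integral r (hankel_kernel t s) + 2 * \<i> * (LINT v:{r..}|lborel. jump (hankel_kernel t s) v)"

text \<open>At l = 0 the parameter alpha cancels, so the results on \<open>log_integrand\<close>
  apply to Hankel's kernel with any alpha in (0, 1); below it is 1/2.\<close>

lemma log_integrand_zero: "log_integrand t \<alpha> s 0 = hankel_kernel t s"
  by (rule ext) (simp add: log_integrand_def hankel_kernel_def algebra_simps flip: exp_diff)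

lemma jump_hankel_kernel:
  assumes "0 < v"
  shows "jump (hankel_kernel t s) v = of_real (exp (- v * t) * v powr - s * sin (s * pi))"
proof -
  have "jump (hankel_kernel t s) v = cut_density t (1/2) s 0 v"
    using cut_density_eq_jump[of "1/2" 0 v t s] assms by (simp add: log_integrand_zero Arg_zero)
  also have "\<dots> = of_real (exp (- v * t) * (v powr (1/2 - s) * v powr (1/2) / v powr 1) * sin (s * pi))"
    by (simp add: cut_density_def)
  also have "v powr (1/2 - s) * v powr (1/2) / v powr 1 = v powr - s"
    unfolding powr_add[symmetric] powr_diff[symmetric] by simp
  finally show ?thesis .
qed

lemma set_lebesgue_integral_jump_hankel_kernel:
  assumes "A \<subseteq> {0<..}"
  shows "(LINT v:A|lborel. jump (hankel_kernel t s) v)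
    = of_real (sin (s * pi) * (LINT v:A|lborel. exp (- v * t) * v powr - s))"
proof -
  have "(LINT v:A|lborel. jump (hankel_kernel t s) v)
      = (LINT v:A|lborel. complex_of_real (sin (s * pi) * (exp (- v * t) * v powr - s)))"
    unfolding set_lebesgue_integral_def
    using assms by (intro Bochner_Integration.integral_cong) (auto simp: indicator_def jump_hankel_kernel)
  also have "\<dots> = of_real (sin (s * pi) * (LINT v:A|lborel. exp (- v * t) * v powr - s))"
    unfolding set_integral_complex_of_real set_integral_mult_right ..
  finally show ?thesis .
qed

text \<open>Away from the origin no upper bound on s is required: v^(- s) \<le> r^(- s) on the tail.
  This is what allows the large exponents n alpha + beta of the series.\<close>

lemma set_integrable_exp_powr_tail:
  fixes t r s :: real
  assumes "0 < t" "0 < r" "0 \<le> s"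
  shows "set_integrable lborel {r..} (\<lambda>v. exp (- v * t) * v powr - s)"
proof (rule set_integrable_bound)
  have "set_integrable lborel {0<..} (\<lambda>v. exp (- v * t) * v powr 0)"
    using assms by (intro integrable_exp_powr) auto
  then have "set_integrable lborel {r..} (\<lambda>v. exp (- v * t) * v powr 0)"
    by (rule set_integrable_subset) (use assms in auto)
  then show "set_integrable lborel {r..} (\<lambda>v. r powr - s * (exp (- v * t) * v powr 0))"
    by (rule set_integrable_mult_right)
  have "continuous_on {r..} (\<lambda>v. exp (- v * t) * v powr - s)"
    using assms by (intro continuous_intros) auto
  then show "set_borel_measurable lborel {r..} (\<lambda>v. exp (- v * t) * v powr - s)"
    using borel_measurable_continuous_on_indicator[of "{r..}" "\<lambda>v. exp (- v * t) * v powr - s"]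
    by (simp add: set_borel_measurable_def)
  have "v powr - s \<le> r powr - s" if "r \<le> v" for v
    using that assms by (intro powr_mono2') auto
  then show "AE v in lborel. v \<in> {r..} \<longrightarrow> norm (exp (- v * t) * v powr - s) \<le> norm (r powr - s * (exp (- v * t) * v powr 0))"
    using assms by (auto intro!: mult_right_mono simp: mult.commute)
qed

text \<open>Integration by parts: the combined integrand \<open>f\<close> is the derivative of - exp
  (- v t) v^(- s), which vanishes at infinity.\<close>

lemma exp_powr_tail_recurrence:
  fixes t r s :: real
  assumes "0 < t" "0 < r" "0 < s"
  shows "t * (LINT v:{r..}|lborel. exp (- v * t) * v powr - s)
    + s * (LINT v:{r..}|lborel. exp (- v * t) * v powr - (s + 1)) = exp (- r * t) * r powr - s"
proof -
  define f where "f = (\<lambda>v. t * (exp (- v * t) * v powr - s) + s * (exp (- v * t) * v powr - (s + 1)))"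
  have int: "set_integrable lborel {r..} (\<lambda>v. exp (- v * t) * v powr - s)"
    "set_integrable lborel {r..} (\<lambda>v. exp (- v * t) * v powr - (s + 1))"
    using assms by (intro set_integrable_exp_powr_tail; simp)+
  then have intf: "set_integrable lborel {r..} f"
    unfolding f_def by (intro set_integral_add set_integrable_mult_right)
  have "((\<lambda>b. LINT v:{r..b}|lborel. f v) \<longlongrightarrow> (LINT v:{r..}|lborel. f v)) at_top"
    by (intro tendsto_set_lebesgue_integral_at_top intf) auto
  moreover have "\<forall>\<^sub>F b in at_top. (LINT v:{r..b}|lborel. f v) = exp (- r * t) * r powr - s - exp (- b * t) * b powr - s"
    using eventually_ge_at_top[of r]
  proof eventually_elim
    case (elim b)
    have "(LINT v:{r..b}|lborel. f v) = - (exp (- b * t) * b powr - s) - - (exp (- r * t) * r powr - s)"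
      unfolding set_lebesgue_integral_def
    proof (rule integral_FTC_atLeastAtMost[OF elim])
      fix v assume v: "r \<le> v" "v \<le> b"
      then have "0 < v" using assms by simp
      then have "((\<lambda>v. - (exp (- v * t) * v powr - s)) has_real_derivative f v) (at v within {r..b})"
        unfolding f_def by (auto intro!: derivative_eq_intros simp: powr_diff powr_minus field_simps)
      then show "((\<lambda>v. - (exp (- v * t) * v powr - s)) has_vector_derivative f v) (at v within {r..b})"
        by (simp add: has_real_derivative_iff_has_vector_derivative)
    next
      show "continuous_on {r..b} f"
        unfolding f_def using assms by (intro continuous_intros) auto
    qed
    then show ?case by simp
  qed
  ultimately have "((\<lambda>b. exp (- r * t) * r powr - s - exp (- b * t) * b powr - s) \<longlongrightarrow> (LINT v:{r..}|lborel. f v)) at_top"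
    by (rule Lim_transform_eventually)
  moreover have "((\<lambda>b. exp (- r * t) * r powr - s - exp (- b * t) * b powr - s) \<longlongrightarrow> exp (- r * t) * r powr - s - 0 * 0) at_top"
  proof (intro tendsto_diff tendsto_mult tendsto_const)
    have "LIM b at_top. t * b :> at_top"
      by (rule filterlim_tendsto_pos_mult_at_top[OF tendsto_const assms(1) filterlim_ident])
    then have "LIM b at_top. - b * t :> at_bot"
      by (simp add: filterlim_uminus_at_bot mult.commute)
    then show "((\<lambda>b. exp (- b * t)) \<longlongrightarrow> 0) at_top"
      by (rule filterlim_compose[OF exp_at_bot])
    show "((\<lambda>b. b powr - s) \<longlongrightarrow> 0) at_top"
      using assms(3) by (intro tendsto_neg_powr filterlim_ident) auto
  qed
  ultimately have "(LINT v:{r..}|lborel. f v) = exp (- r * t) * r powr - s"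
    using tendsto_unique[OF trivial_limit_at_top_linorder] by fastforce
  then show ?thesis
    unfolding f_def using int by (simp add: set_integral_add(2))
qed

lemma continuous_hankel_kernel: "continuous_on A (hankel_kernel t s)"
  unfolding hankel_kernel_def by (intro continuous_intros)

text \<open>The counterpart of Gamma (s + 1) = s Gamma s. The kernel combination is the derivative
  of exp (t z) z^(- s) in w; its boundary values at the ends of the circle cancel the boundary term
  at r of the tail recurrence.\<close>

lemma hankel_integral_Suc:
  assumes "0 < t" "0 < r" "0 < s"
  shows "of_real s * hankel_integral t r (s + 1) = of_real t * hankel_integral t r s"
proof -
  let ?l = "linepath (of_real (ln r) - \<i> * of_real pi) (of_real (ln r) + \<i> * of_real pi)"
  define E where "E = (\<lambda>w. exp (exp w * complex_of_real t + of_real (- s) * w))"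
  have int: "hankel_kernel t s' contour_integrable_on ?l" for s'
    by (intro contour_integrable_continuous_linepath continuous_hankel_kernel)
  have c1: "((\<lambda>w. of_real t * hankel_kernel t s w - of_real s * hankel_kernel t (s + 1) w) has_contour_integral
     E (pathfinish ?l) - E (pathstart ?l)) ?l"
  proof (rule contour_integral_primitive[of UNIV])
    fix w
    have "hankel_kernel t s w = exp w * E w" "hankel_kernel t (s + 1) w = E w"
      by (simp_all add: hankel_kernel_def E_def algebra_simps flip: exp_add)
    then show "(E has_field_derivative of_real t * hankel_kernel t s w - of_real s * hankel_kernel t (s + 1) w) (at w within UNIV)"
      unfolding E_def by (auto intro!: derivative_eq_intros simp: algebra_simps)
  qed auto
  have c2: "((\<lambda>w. of_real t * hankel_kernel t s w - of_real s * hankel_kernel t (s + 1) w) has_contour_integral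
     of_real t * vertical_integral r (hankel_kernel t s) - of_real s * vertical_integral r (hankel_kernel t (s + 1))) ?l"
    unfolding vertical_integral_def
    by (intro has_contour_integral_diff has_contour_integral_lmul has_contour_integral_integral int)
  have "E (of_real (ln r) + \<i> * of_real \<phi>) = of_real (exp (- r * t) * r powr - s) * cis (- s * \<phi>)"
    if "\<phi> = pi \<or> \<phi> = - pi" for \<phi>
  proof -
    let ?w = "of_real (ln r) + \<i> * of_real \<phi>"
    have "E ?w = exp (exp ?w * of_real t) * exp (of_real (- s) * ?w)"
      unfolding E_def by (rule exp_add)
    also have "\<dots> = exp (- of_real r * of_real t) * (of_real (r powr - s) * cis (- s * \<phi>))"
      by (simp only: exp_log_side[OF assms(2) that] exp_log_polar[OF assms(2)])
    finally show ?thesis by (simp flip: exp_of_real)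
  qed
  from this[of pi] this[of "- pi"]
  have "E (pathfinish ?l) - E (pathstart ?l) = - (2 * \<i> * of_real (sin (s * pi) * (exp (- r * t) * r powr - s)))"
    by (simp add: complex_eq_iff algebra_simps)
  then have V: "of_real t * vertical_integral r (hankel_kernel t s) - of_real s * vertical_integral r (hankel_kernel t (s + 1))
      = - (2 * \<i> * of_real (sin (s * pi) * (exp (- r * t) * r powr - s)))"
    using has_contour_integral_unique[OF c2 c1] by simp
  define J where "J = (LINT v:{r..}|lborel. exp (- v * t) * v powr - s)"
  define J' where "J' = (LINT v:{r..}|lborel. exp (- v * t) * v powr - (s + 1))"
  have J: "t * J + s * J' = exp (- r * t) * r powr - s"
    unfolding J_def J'_def by (rule exp_powr_tail_recurrence) fact+
  have sub: "{r..} \<subseteq> {0<..}" using assms by auto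
  \<comment> \<open>This sign turns the difference of the two tail integrals into the sum t J + s J'
    of the recurrence.\<close>
  have "sin ((s + 1) * pi) = - sin (s * pi)" by (simp add: distrib_right)
  then have "of_real t * hankel_integral t r s - of_real s * hankel_integral t r (s + 1)
     = (of_real t * vertical_integral r (hankel_kernel t s) - of_real s * vertical_integral r (hankel_kernel t (s + 1)))
       + 2 * \<i> * of_real (sin (s * pi) * (t * J + s * J'))"
    unfolding hankel_integral_def set_lebesgue_integral_jump_hankel_kernel[OF sub] J_def[symmetric] J'_def[symmetric]
    by (simp add: algebra_simps)
  also have "\<dots> = 0" unfolding V J by simp
  finally show ?thesis by simp
qed

text \<open>At s = 1 the kernel is exp (t exp w) = 1 + exp w g(exp w) with g entire, so it has the
  primitive w + F(exp w) with F' = g.\<close>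

lemma hankel_integral_1:
  assumes "0 < r"
  shows "hankel_integral t r 1 = 2 * of_real pi * \<i>"
proof -
  let ?l = "linepath (of_real (ln r) - \<i> * of_real pi) (of_real (ln r) + \<i> * of_real pi)"
  define f where "f = (\<lambda>z. exp (z * complex_of_real t))"
  define g where "g = (\<lambda>z. if z = 0 then deriv f 0 else (f z - f 0) / (z - 0))"
  have "g holomorphic_on UNIV"
    unfolding g_def by (rule pole_lemma_open) (auto simp: f_def intro!: holomorphic_intros)
  then obtain F where F: "\<And>z. (F has_field_derivative g z) (at z)"
    using holomorphic_convex_primitive'[of UNIV g] by auto
  have "(hankel_kernel t 1 has_contour_integral (pathfinish ?l + F (exp (pathfinish ?l))) - (pathstart ?l + F (exp (pathstart ?l)))) ?l"
  proof (rule contour_integral_primitive[where S = UNIV and f = "\<lambda>w. w + F (exp w)"])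
    fix w
    have "((\<lambda>w. w + F (exp w)) has_field_derivative 1 + g (exp w) * exp w) (at w)"
      by (intro derivative_intros DERIV_chain2[OF F]) auto
    moreover have "1 + g (exp w) * exp w = hankel_kernel t 1 w"
      by (simp add: g_def f_def hankel_kernel_def)
    ultimately show "((\<lambda>w. w + F (exp w)) has_field_derivative hankel_kernel t 1 w) (at w within UNIV)" by simp
  qed auto
  moreover have "exp (pathfinish ?l) = exp (pathstart ?l)"
    using exp_log_side[OF assms, of pi] exp_log_side[OF assms, of "- pi"] by simp
  ultimately have "vertical_integral r (hankel_kernel t 1) = 2 * of_real pi * \<i>"
    by (simp add: vertical_integral_def contour_integral_unique)
  moreover have "{r..} \<subseteq> {0<..}" using assms by auto
  ultimately show ?thesis
    by (simp add: hankel_integral_def set_lebesgue_integral_jump_hankel_kernel)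
qed

text \<open>For s < 1 the contour shrinks onto the cut, without a pole in between. Euler's integral
  then gives sin (s pi) Gamma (1 - s), which the reflection formula turns into pi / Gamma s.\<close>

lemma hankel_integral_0_1:
  assumes "0 < t" "0 < r" "0 < s" "s < 1"
  shows "hankel_integral t r s = 2 * of_real pi * \<i> * of_real (t powr (s - 1) / Gamma s)"
proof -
  have no_root: "\<not> is_branch_root (1/2) 0 z" for z
    by (auto simp: is_branch_root_def)
  then have "branch_residue t (1/2) s 0 = 0" by (simp add: branch_residue_def)
  then have "hankel_integral t r s = 2 * \<i> * (LINT v:{0<..}|lborel. jump (hankel_kernel t s) v)"
    using vertical_integral_shrink[of t "1/2" 0 s r] assms no_root
    by (simp add: hankel_integral_def log_integrand_zero Arg_zero)
  also have "\<dots> = 2 * \<i> * of_real (sin (s * pi) * (Gamma (- s + 1) / t powr (- s + 1)))"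
    using assms by (simp add: set_lebesgue_integral_jump_hankel_kernel integral_exp_powr[of t "- s", simplified])
  also have "sin (s * pi) * (Gamma (- s + 1) / t powr (- s + 1)) = pi * (t powr (s - 1) / Gamma s)"
  proof -
    have "complex_of_real (Gamma s * Gamma (1 - s)) = of_real (pi / sin (pi * s))"
      using Gamma_reflection_complex[of "of_real s"] by (simp add: Gamma_complex_of_real sin_of_real flip: of_real_diff)
        (metis Gamma_complex_of_real of_real_1 of_real_diff of_real_divide of_real_mult sin_of_real)
    then have "Gamma s * Gamma (1 - s) = pi / sin (pi * s)" by (simp only: of_real_eq_iff)
    moreover have "sin (pi * s) > 0" using assms by (intro sin_gt_zero) auto
    moreover have "Gamma s > 0" using assms by (intro Gamma_real_pos)
    ultimately have "sin (s * pi) * Gamma (- s + 1) = pi / Gamma s"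
      by (simp add: field_simps)
    moreover have "t powr (s - 1) = 1 / t powr (- s + 1)"
      using powr_minus_divide[of t "- s + 1"] by simp
    ultimately show ?thesis by (simp add: field_simps)
  qed
  finally show ?thesis by (simp add: mult_ac)
qed

text \<open>Induction over the ranges 0 < s \<le> n + 1, lowering s by 1. The base range includes s
  = 1, where the contour cannot be shrunk onto the cut and the direct evaluation is used.\<close>

lemma hankel_integral_eq:
  assumes "0 < t" "0 < r" "0 < s"
  shows "hankel_integral t r s = 2 * of_real pi * \<i> * of_real (t powr (s - 1) / Gamma s)"
proof -
  have "hankel_integral t r s = 2 * of_real pi * \<i> * of_real (t powr (s - 1) / Gamma s)"
    if "0 < s" "s \<le> real n + 1" for n s
    using that
  proof (induction n arbitrary: s)
    case 0
    then show ?case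
      using hankel_integral_1[OF assms(2), of t] hankel_integral_0_1[OF assms(1,2), of s] assms(1)
      by (cases "s = 1") auto
  next
    case (Suc n)
    show ?case
    proof (cases "s \<le> 1")
      case True
      then show ?thesis using Suc by simp
    next
      case False
      then have s: "0 < s - 1" "s - 1 \<le> real n + 1" using Suc.prems by auto
      have "Gamma s = (s - 1) * Gamma (s - 1)"
        using Gamma_plus1[of "s - 1"] s(1) by (auto simp: nonpos_Ints_def)
      moreover have "t powr (s - 1) = t powr (s - 1 - 1) * t"
        using assms(1) powr_add[of t "s - 1 - 1" 1] by simp
      moreover have "hankel_integral t r s = of_real t * hankel_integral t r (s - 1) / of_real (s - 1)"
        using hankel_integral_Suc[OF assms(1,2) s(1)] s(1) by (simp add: field_simps)
      ultimately show ?thesis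
        using Suc.IH[OF s] by (simp add: mult_ac)
    qed
  qed
  from this[of s "nat \<lceil>s\<rceil>"] assms(3) show ?thesis by linarith
qed

section \<open>Termwise integration of the geometric series\<close>

text \<open>With x = exp (alpha w) and |x| > |l|, 1 / (x - l) is the sum of l^n / x^(n + 1); the
  powers of x shift the exponent of the kernel from beta to n alpha + beta. The second claim
  supplies the majorants.\<close>

lemma hankel_kernel_geometric:
  assumes "cmod l < exp (\<alpha> * Re w)"
  shows "(\<lambda>n. l ^ n * hankel_kernel t (real n * \<alpha> + \<beta>) w) sums log_integrand t \<alpha> \<beta> l w"
    and "cmod (l ^ n * hankel_kernel t (real n * \<alpha> + \<beta>) w) = cmod (hankel_kernel t \<beta> w) * (cmod l / exp (\<alpha> * Re w)) ^ n"
proof -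
  define u where "u = l / exp (of_real \<alpha> * w)"
  have u: "cmod u = cmod l / exp (\<alpha> * Re w)" by (simp add: u_def norm_divide norm_exp_eq_Re)
  have f: "l ^ n * hankel_kernel t (real n * \<alpha> + \<beta>) w = hankel_kernel t \<beta> w * u ^ n" for n
  proof -
    have "hankel_kernel t (real n * \<alpha> + \<beta>) w = hankel_kernel t \<beta> w / exp (of_nat n * (of_real \<alpha> * w))"
      unfolding hankel_kernel_def exp_diff[symmetric] by (simp add: algebra_simps)
    then show ?thesis
      by (simp add: u_def power_divide exp_of_nat_mult)
  qed
  have "cmod u < 1" unfolding u using assms by simp
  then have "(\<lambda>n. hankel_kernel t \<beta> w * u ^ n) sums (hankel_kernel t \<beta> w * (1 / (1 - u)))"
    by (intro sums_mult geometric_sums)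
  also have "hankel_kernel t \<beta> w * (1 / (1 - u)) = log_integrand t \<alpha> \<beta> l w"
  proof -
    have "exp (of_real \<alpha> * w) - l \<noteq> 0" using assms by (auto simp: norm_exp_eq_Re)
    moreover have "1 - u = (exp (of_real \<alpha> * w) - l) / exp (of_real \<alpha> * w)" by (simp add: u_def diff_divide_distrib)
    moreover have "exp (exp w * of_real t + of_real (\<alpha> - \<beta> + 1) * w) = hankel_kernel t \<beta> w * exp (of_real \<alpha> * w)"
      unfolding hankel_kernel_def exp_add[symmetric] by (simp add: algebra_simps)
    ultimately show ?thesis by (simp add: log_integrand_def)
  qed
  finally show "(\<lambda>n. l ^ n * hankel_kernel t (real n * \<alpha> + \<beta>) w) sums log_integrand t \<alpha> \<beta> l w"
    by (simp add: f)
  show "cmod (l ^ n * hankel_kernel t (real n * \<alpha> + \<beta>) w) = cmod (hankel_kernel t \<beta> w) * (cmod l / exp (\<alpha> * Re w)) ^ n"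
    by (simp add: f norm_mult norm_power u)
qed

text \<open>On the compact segment the kernel is bounded and the ratio |l| / r^alpha < 1 is
  constant, so the M-test gives uniform convergence.\<close>

lemma vertical_integral_sums:
  assumes "0 < r" "cmod l < r powr \<alpha>"
  shows "(\<lambda>n. l ^ n * vertical_integral r (hankel_kernel t (real n * \<alpha> + \<beta>))) sums vertical_integral r (log_integrand t \<alpha> \<beta> l)"
proof -
  let ?a = "of_real (ln r) - \<i> * of_real pi" and ?b = "of_real (ln r) + \<i> * of_real pi"
  define f where "f = (\<lambda>n w. l ^ n * hankel_kernel t (real n * \<alpha> + \<beta>) w)"
  have Re: "Re w = ln r" if "w \<in> closed_segment ?a ?b" for w
    using that by (subst (asm) closed_segment_same_Re) auto
  have r: "exp (\<alpha> * ln r) = r powr \<alpha>" using assms(1) by (simp add: powr_def)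
  obtain B where B: "\<And>w. w \<in> closed_segment ?a ?b \<Longrightarrow> cmod (hankel_kernel t \<beta> w) \<le> B"
    using compact_imp_bounded[OF compact_continuous_image[OF continuous_hankel_kernel compact_segment], of t \<beta> ?a ?b]
    by (auto simp: bounded_iff)
  have q: "cmod l / r powr \<alpha> < 1" using assms by (simp add: field_simps)
  have "uniform_limit (closed_segment ?a ?b) (\<lambda>N w. \<Sum>n<N. f n w) (\<lambda>w. suminf (\<lambda>n. f n w)) sequentially"
  proof (rule Weierstrass_m_test)
    show "cmod (f n w) \<le> B * (cmod l / r powr \<alpha>) ^ n" if "w \<in> closed_segment ?a ?b" for n w
      unfolding f_def using assms(2) B[OF that] Re[OF that] r
      by (subst hankel_kernel_geometric(2)) (auto intro!: mult_right_mono)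
    show "summable (\<lambda>n. B * (cmod l / r powr \<alpha>) ^ n)"
      using q by (intro summable_mult summable_geometric) simp
  qed
  moreover have "suminf (\<lambda>n. f n w) = log_integrand t \<alpha> \<beta> l w" if "w \<in> closed_segment ?a ?b" for w
    unfolding f_def using hankel_kernel_geometric(1)[of l \<alpha> w t \<beta>] assms(2) Re[OF that] r
    by (simp add: sums_unique[symmetric])
  ultimately have "uniform_limit (closed_segment ?a ?b) (\<lambda>N w. \<Sum>n<N. f n w) (log_integrand t \<alpha> \<beta> l) sequentially"
    by (subst uniform_limit_cong'[where g = "\<lambda>N w. \<Sum>n<N. f n w" and i = "\<lambda>w. suminf (\<lambda>n. f n w)"]) auto
  then obtain J where J: "(log_integrand t \<alpha> \<beta> l has_contour_integral J) (linepath ?a ?b)"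
    "(\<lambda>n. contour_integral (linepath ?a ?b) (f n)) sums J"
    by (rule contour_integral_sums_linepath) (auto simp: f_def intro!: continuous_intros continuous_hankel_kernel)
  have "contour_integral (linepath ?a ?b) (f n) = l ^ n * vertical_integral r (hankel_kernel t (real n * \<alpha> + \<beta>))" for n
    unfolding f_def vertical_integral_def
    by (intro contour_integral_lmul contour_integrable_continuous_linepath continuous_hankel_kernel)
  moreover have "J = vertical_integral r (log_integrand t \<alpha> \<beta> l)"
    using J(1) by (simp add: vertical_integral_def contour_integral_unique)
  ultimately show ?thesis using J(2) by simp
qed

text \<open>The half-line has infinite length, so uniform convergence is replaced by summability of
  the L1 norms. For v \<ge> r the n-th term is at most q^n times one integrable function, since
  |l|^n v^(- n alpha) \<le> q^n.\<close>

lemma jump_tail_sums: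
  assumes "0 < t" "0 < r" "0 < \<alpha>" "0 < \<beta>" "cmod l < r powr \<alpha>"
  shows "(\<lambda>n. l ^ n * (LINT v:{r..}|lborel. jump (hankel_kernel t (real n * \<alpha> + \<beta>)) v))
    sums (LINT v:{r..}|lborel. jump (log_integrand t \<alpha> \<beta> l) v)"
proof -
  define q where "q = cmod l / r powr \<alpha>"
  have q: "0 \<le> q" "q < 1" using assms by (auto simp: q_def field_simps)
  define f where "f = (\<lambda>n v. indicator {r..} v *\<^sub>R (l ^ n * jump (hankel_kernel t (real n * \<alpha> + \<beta>)) v))"
  define b where "b = (\<lambda>v. indicator {r..} v *\<^sub>R (exp (- v * t) * v powr - \<beta>))"
  have intb: "integrable lborel b"
    using set_integrable_exp_powr_tail[of t r \<beta>] assms by (simp add: b_def set_integrable_def)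
  have f_real: "f n v = l ^ n * of_real (sin ((real n * \<alpha> + \<beta>) * pi)) *
      of_real (indicator {r..} v *\<^sub>R (exp (- v * t) * v powr - (real n * \<alpha> + \<beta>)))" for n v
    using assms(2) by (auto simp: f_def indicator_def jump_hankel_kernel)
  have intf: "integrable lborel (f n)" for n
  proof -
    have "integrable lborel (\<lambda>v. indicator {r..} v *\<^sub>R (exp (- v * t) * v powr - (real n * \<alpha> + \<beta>)))"
      using set_integrable_exp_powr_tail[of t r "real n * \<alpha> + \<beta>"] assms by (simp add: set_integrable_def)
    then show ?thesis
      unfolding f_real[abs_def] by (intro integrable_mult_right integrable_of_real) 
  qed
  have bound: "norm (f n v) \<le> q ^ n * b v" for n v
  proof (cases "r \<le> v")
    case True
    have "v powr - (real n * \<alpha>) \<le> r powr - (real n * \<alpha>)"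
      using True assms by (intro powr_mono2') auto
    also have "r powr - (real n * \<alpha>) = 1 / (r powr \<alpha>) ^ n"
      using assms(2) by (simp add: powr_minus_divide powr_powr powr_realpow[symmetric] mult.commute)
    finally have "v powr - (real n * \<alpha>) * v powr - \<beta> \<le> 1 / (r powr \<alpha>) ^ n * v powr - \<beta>"
      by (rule mult_right_mono) simp
    then have 1: "v powr - (real n * \<alpha> + \<beta>) \<le> 1 / (r powr \<alpha>) ^ n * v powr - \<beta>"
      using powr_add[of v "- (real n * \<alpha>)" "- \<beta>"] by simp
    have "norm (f n v) = cmod l ^ n * \<bar>sin ((real n * \<alpha> + \<beta>) * pi)\<bar> * (exp (- v * t) * v powr - (real n * \<alpha> + \<beta>))"
      using True unfolding f_real by (simp add: norm_mult norm_power)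
    also have "\<dots> \<le> cmod l ^ n * 1 * (exp (- v * t) * (1 / (r powr \<alpha>) ^ n * v powr - \<beta>))"
      using 1 by (intro mult_mono mult_left_mono) auto
    also have "\<dots> = q ^ n * b v" using True by (simp add: q_def b_def power_divide)
    finally show ?thesis .
  qed (auto simp: f_def b_def)
  have "(\<lambda>n. integral\<^sup>L lborel (f n)) sums (\<integral>v. (\<Sum>n. f n v) \<partial>lborel)"
  proof (rule sums_integral[OF intf])
    have sq: "summable (\<lambda>n. q ^ n * c)" for c
      using q by (intro summable_mult2 summable_geometric) simp
    show "AE v in lborel. summable (\<lambda>n. norm (f n v))"
      using bound by (intro AE_I2 summable_comparison_test[OF _ sq]) auto
    have "(\<integral>v. norm (f n v) \<partial>lborel) \<le> q ^ n * integral\<^sup>L lborel b" for n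
    proof -
      have "(\<integral>v. norm (f n v) \<partial>lborel) \<le> (\<integral>v. q ^ n * b v \<partial>lborel)"
        by (intro integral_mono integrable_norm intf integrable_mult_right intb bound)
      then show ?thesis by simp
    qed
    then show "summable (\<lambda>n. \<integral>v. norm (f n v) \<partial>lborel)"
      by (intro summable_comparison_test[OF _ sq]) (auto intro!: exI[of _ 0])
  qed
  also have "(\<lambda>n. integral\<^sup>L lborel (f n)) = (\<lambda>n. l ^ n * (LINT v:{r..}|lborel. jump (hankel_kernel t (real n * \<alpha> + \<beta>)) v))"
  proof
    show "integral\<^sup>L lborel (f n) = l ^ n * (LINT v:{r..}|lborel. jump (hankel_kernel t (real n * \<alpha> + \<beta>)) v)" for n
      unfolding f_def by (simp only: set_integral_mult_right flip: set_lebesgue_integral_def)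
  qed
  also have "(\<integral>v. (\<Sum>n. f n v) \<partial>lborel) = (LINT v:{r..}|lborel. jump (log_integrand t \<alpha> \<beta> l) v)"
    unfolding set_lebesgue_integral_def
  proof (intro Bochner_Integration.integral_cong refl)
    fix v
    show "(\<Sum>n. f n v) = indicator {r..} v *\<^sub>R jump (log_integrand t \<alpha> \<beta> l) v"
    proof (cases "r \<le> v")
      case True
      have "r powr \<alpha> \<le> v powr \<alpha>" using True assms by (intro powr_mono2) auto
      then have "cmod l < v powr \<alpha>" using assms by simp
      moreover have "v powr \<alpha> = exp (\<alpha> * ln v)" using assms True by (simp add: powr_def)
      ultimately have "cmod l < exp (\<alpha> * ln v)" by simp
      then have "(\<lambda>n. (l ^ n * hankel_kernel t (real n * \<alpha> + \<beta>) (of_real (ln v) + \<i> * of_real pi)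
          - l ^ n * hankel_kernel t (real n * \<alpha> + \<beta>) (of_real (ln v) - \<i> * of_real pi)) / (2 * \<i> * of_real v))
        sums jump (log_integrand t \<alpha> \<beta> l) v"
        unfolding jump_def by (intro sums_divide sums_diff hankel_kernel_geometric(1)) simp_all
      also have "(\<lambda>n. (l ^ n * hankel_kernel t (real n * \<alpha> + \<beta>) (of_real (ln v) + \<i> * of_real pi)
          - l ^ n * hankel_kernel t (real n * \<alpha> + \<beta>) (of_real (ln v) - \<i> * of_real pi)) / (2 * \<i> * of_real v))
        = (\<lambda>n. f n v)"
        using True by (simp add: f_def jump_def right_diff_distrib)
      finally show ?thesis using True by (simp add: sums_unique[symmetric])
    qed (simp add: f_def)
  qed
  finally show ?thesis .
qed

lemma mittag_leffler_eq:
  assumes "0 < t" "0 < \<alpha>" "\<alpha> < 1" "0 < \<beta>" "\<beta> < \<alpha> + 1" "\<bar>Arg l\<bar> \<noteq> \<alpha> * pi" "l \<noteq> 0 \<or> \<beta> < 1"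
  shows "of_real (t powr (\<beta> - 1)) * mittag_leffler \<alpha> \<beta> (l * of_real (t powr \<alpha>))
    = branch_residue t \<alpha> \<beta> l + 1 / of_real pi * (LINT v:{0<..}|lborel. jump (log_integrand t \<alpha> \<beta> l) v)"
proof -
  \<comment> \<open>Chosen so that r^alpha = |l| + 1: the geometric series converges on the whole
    contour, and the root, with |z|^alpha = |l|, lies inside the circle.\<close>
  define r where "r = (cmod l + 1) powr (1 / \<alpha>)"
  have r: "0 < r" "r powr \<alpha> = cmod l + 1"
  proof -
    have "cmod l + 1 > 0" by (smt (verit) norm_ge_zero)
    then show "0 < r" "r powr \<alpha> = cmod l + 1"
      using assms(2) by (auto simp: r_def powr_powr)
  qed
  have root: "cmod z < r" if "is_branch_root \<alpha> l z" for z
  proof -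
    have "cmod l = cmod z powr \<alpha>"
      using that by (auto simp: is_branch_root_def norm_powr_real_powr')
    then have "cmod z powr \<alpha> < r powr \<alpha>" using r by simp
    then show ?thesis using assms(2) r(1) by (metis norm_ge_zero not_less powr_mono2 less_imp_le)
  qed
  define X where "X = vertical_integral r (log_integrand t \<alpha> \<beta> l) + 2 * \<i> * (LINT v:{r..}|lborel. jump (log_integrand t \<alpha> \<beta> l) v)"
  define a where "a = (\<lambda>n. (l * of_real (t powr \<alpha>)) ^ n / of_real (Gamma (real n * \<alpha> + \<beta>)))"
  \<comment> \<open>The part of Hankel's value 2 pi i t^(n alpha + beta - 1) / Gamma (n alpha +
    beta) that is free of n; the remaining t^(n alpha) enters the argument of the Mittag-Leffler
    series.\<close>
  define C where "C = 2 * of_real pi * \<i> * of_real (t powr (\<beta> - 1))"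
  have "C \<noteq> 0" using assms(1) by (simp add: C_def)
  have lt: "cmod l < r powr \<alpha>" using r by simp
  have "(\<lambda>n. l ^ n * vertical_integral r (hankel_kernel t (real n * \<alpha> + \<beta>))
      + 2 * \<i> * (l ^ n * (LINT v:{r..}|lborel. jump (hankel_kernel t (real n * \<alpha> + \<beta>)) v))) sums X"
    unfolding X_def
    by (intro sums_add sums_mult vertical_integral_sums jump_tail_sums r(1) lt assms)
  also have "(\<lambda>n. l ^ n * vertical_integral r (hankel_kernel t (real n * \<alpha> + \<beta>))
      + 2 * \<i> * (l ^ n * (LINT v:{r..}|lborel. jump (hankel_kernel t (real n * \<alpha> + \<beta>)) v))) = (\<lambda>n. C * a n)"
  proof
    fix n
    have s: "0 < real n * \<alpha> + \<beta>" using assms by (simp add: add_nonneg_pos)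
    have "t powr (real n * \<alpha> + \<beta> - 1) = t powr (\<beta> - 1) * (t powr \<alpha>) ^ n"
      using assms(1) powr_add[of t "\<beta> - 1" "real n * \<alpha>"]
      by (simp add: powr_powr powr_realpow[symmetric] algebra_simps)
    then have "l ^ n * hankel_integral t r (real n * \<alpha> + \<beta>) = C * a n"
      unfolding hankel_integral_eq[OF assms(1) r(1) s] by (simp add: C_def a_def power_mult_distrib mult_ac)
    then show "l ^ n * vertical_integral r (hankel_kernel t (real n * \<alpha> + \<beta>))
      + 2 * \<i> * (l ^ n * (LINT v:{r..}|lborel. jump (hankel_kernel t (real n * \<alpha> + \<beta>)) v)) = C * a n"
      by (simp add: hankel_integral_def distrib_left mult_ac)
  qed
  finally have "(\<lambda>n. C * a n / C) sums (X / C)" by (rule sums_divide)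
  then have "a sums (X / C)" using \<open>C \<noteq> 0\<close> by simp
  then have "mittag_leffler \<alpha> \<beta> (l * of_real (t powr \<alpha>)) = X / C"
    unfolding mittag_leffler_def a_def by (rule sums_unique[symmetric])
  moreover have "X = 2 * of_real pi * \<i> * branch_residue t \<alpha> \<beta> l
      + 2 * \<i> * (LINT v:{0<..}|lborel. jump (log_integrand t \<alpha> \<beta> l) v)"
    unfolding X_def by (rule vertical_integral_shrink) (use assms r root in auto)
  moreover have "of_real (t powr (\<beta> - 1)) * (X / C) = X / (2 * of_real pi * \<i>)"
    using assms(1) by (simp add: C_def)
  ultimately show ?thesis by (simp add: add_divide_distrib)
qed

text \<open>The pole is the branch root and not l, and c > Re l alone does not place it to the left
  of FA: l = 2 and alpha = 1/2 have the root 4. Hence the premise on the roots in the first part. In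
  the second part l = 0 with beta \<ge> 1 is excluded: for beta = 1 the density and the residue
  vanish while the left side is 1, and for beta > 1 the density is not integrable at 0.\<close>

theorem theorem3p1:
  fixes t \<alpha> \<beta> c :: real and l :: complex
  assumes "0 < t" and "0 < \<alpha>" and "\<alpha> < 1" and "0 < \<beta>" and "\<beta> < \<alpha> + 1"
    and "max (Re l) 0 < c"
    and no_pole_on_cut: "\<bar>Arg l\<bar> \<noteq> \<alpha> * pi"
  shows "((\<forall>z. is_branch_root \<alpha> l z \<longrightarrow> Re z < c) \<longrightarrow>
           (\<exists>R\<^sub>0 \<rho>\<^sub>0. c < R\<^sub>0 \<and> 0 < \<rho>\<^sub>0 \<and>
             (\<forall>R \<rho>. R\<^sub>0 < R \<longrightarrow> 0 < \<rho> \<longrightarrow> \<rho> < \<rho>\<^sub>0 \<longrightarrow>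
               1 / (2 * of_real pi * \<i>) * cut_contour_integral c R \<rho> (integrand t \<alpha> \<beta> l)
                 = branch_residue t \<alpha> \<beta> l)))
       \<and> (l \<noteq> 0 \<or> \<beta> < 1 \<longrightarrow>
           set_integrable lborel {0<..} (cut_density t \<alpha> \<beta> l) \<and>
           of_real (t powr (\<beta> - 1)) * mittag_leffler \<alpha> \<beta> (l * of_real (t powr \<alpha>))
             = branch_residue t \<alpha> \<beta> l
               + 1 / of_real pi * (LINT v:{0<..}|lborel. cut_density t \<alpha> \<beta> l v))"
proof (intro conjI impI)
  have c: "0 < c" using assms by simp
  assume Re: "\<forall>z. is_branch_root \<alpha> l z \<longrightarrow> Re z < c"
  obtain z0 where z0: "z0 \<notin> \<real>\<^sub>\<le>\<^sub>0" "\<And>z. is_branch_root \<alpha> l z \<Longrightarrow> z = z0" "Re z0 < c"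
  proof (rule obtain_branch_root[OF assms(2,3), of "of_real (c / 2)" "\<lambda>z. Re z < c" l])
    show "of_real (c / 2) \<notin> (\<real>\<^sub>\<le>\<^sub>0 :: complex set)" "Re (of_real (c / 2)) < c"
      using c by (auto simp: complex_nonpos_Reals_iff)
  qed (use Re in auto)
  \<comment> \<open>Beyond this radius the arcs enclose z0 and R - c > 1. The next bound therefore
    ensures rho < R - c and keeps z0 outside the small circle.\<close>
  define R\<^sub>0 where "R\<^sub>0 = c + 1 + cmod (z0 - of_real c)"
  define \<rho>\<^sub>0 where "\<rho>\<^sub>0 = min 1 (cmod z0)"
  have "z0 \<noteq> 0" using z0(1) by auto
  show "\<exists>R\<^sub>0 \<rho>\<^sub>0. c < R\<^sub>0 \<and> 0 < \<rho>\<^sub>0 \<and> (\<forall>R \<rho>. R\<^sub>0 < R \<longrightarrow> 0 < \<rho> \<longrightarrow> \<rho> < \<rho>\<^sub>0 \<longrightarrow>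
      1 / (2 * of_real pi * \<i>) * cut_contour_integral c R \<rho> (integrand t \<alpha> \<beta> l) = branch_residue t \<alpha> \<beta> l)"
  proof (intro exI conjI allI impI)
    show "c < R\<^sub>0" by (simp add: R\<^sub>0_def add_pos_nonneg)
    show "0 < \<rho>\<^sub>0" using \<open>z0 \<noteq> 0\<close> by (simp add: \<rho>\<^sub>0_def)
    fix R \<rho> assume R: "R\<^sub>0 < R" and \<rho>: "0 < \<rho>" "\<rho> < \<rho>\<^sub>0"
    have R': "c + 1 < R" "cmod (z0 - of_real c) < R"
      using R c norm_ge_zero[of "z0 - of_real c"] unfolding R\<^sub>0_def by linarith+
    have "cut_contour_integral c R \<rho> (integrand t \<alpha> \<beta> l) = 2 * of_real pi * \<i> * branch_residue t \<alpha> \<beta> l"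
      by (rule cut_contour_integral_eq_residue[OF assms(2,3,7) z0(1,2)])
        (use c z0(3) R' \<rho> in \<open>auto simp: \<rho>\<^sub>0_def\<close>)
    then show "1 / (2 * of_real pi * \<i>) * cut_contour_integral c R \<rho> (integrand t \<alpha> \<beta> l) = branch_residue t \<alpha> \<beta> l"
      by simp
  qed
next
  assume l: "l \<noteq> 0 \<or> \<beta> < 1"
  have eq: "cut_density t \<alpha> \<beta> l v = jump (log_integrand t \<alpha> \<beta> l) v" if "v \<in> {0<..}" for v
    using cut_density_eq_jump[OF assms(2,3,7)] that by simp
  show "set_integrable lborel {0<..} (cut_density t \<alpha> \<beta> l)"
    using set_integrable_jump[OF assms(1-3,7,5) l]
      set_integrable_cong[of lborel lborel "{0<..}" "{0<..}" "cut_density t \<alpha> \<beta> l", OF refl refl eq] by simp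
  have "(LINT v:{0<..}|lborel. cut_density t \<alpha> \<beta> l v) = (LINT v:{0<..}|lborel. jump (log_integrand t \<alpha> \<beta> l) v)"
    unfolding set_lebesgue_integral_def
    by (intro Bochner_Integration.integral_cong) (auto simp: indicator_def eq)
  then show "of_real (t powr (\<beta> - 1)) * mittag_leffler \<alpha> \<beta> (l * of_real (t powr \<alpha>))
      = branch_residue t \<alpha> \<beta> l + 1 / of_real pi * (LINT v:{0<..}|lborel. cut_density t \<alpha> \<beta> l v)"
    using mittag_leffler_eq[OF assms(1-5,7) l] by simp
qed

end
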